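(* Let $(\mathcal{S},\mathcal{A},\mathcal{P},r,\gamma)$ be a discounted MDP with $\gamma\in(0,1)$, $r(s,a)\in[0,1]$ for all $(s,a)\in\mathcal{S}\times\mathcal{A}$, and $\|Q^*\|_\infty\ge1$. Let $0<\varepsilon\le1/(1-\gamma)$, $\delta\in(0,1)$, and let $(Q^N,T^N,\pi^N)$ be the output of $\mathrm{SAVID}\textbf{+}(Q^0,\varepsilon(1-\gamma)/24,\delta,\gamma)$ with $Q^0=0$, run with $c_k=5(k+2)\ln^2(k+2)$ and $\beta_k=k/(k+2)$. Then, with probability at least $1-\delta$, $$\|Q^*-Q_{\pi^N}\|_\infty\le\frac{2}{1-\gamma}\|Q^N-\mathcal{T}_\gamma(Q^N)\|_\infty\le\varepsilon,$$ with sample and time complexity $$O\!\left(\widetilde{L}_\gamma\,\frac{|\mathcal{S}||\mathcal{A}|\,\|Q^*\|_\infty^2}{(1-\gamma)^2\varepsilon^2}\right),\qquad\widetilde{L}_\gamma=\ln\!\Big(\frac{2|\mathcal{S}||\mathcal{A}|}{(1-\gamma)\varepsilon\delta}\Big)\ln^4\!\Big(\frac{2}{(1-\gamma)\varepsilon}\Big).$$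
   Context: A discounted MDP $(\mathcal{S},\mathcal{A},\mathcal{P},r,\gamma)$ has finite state space $\mathcal{S}$, finite action space $\mathcal{A}$, transition kernel $\mathcal{P}$ (each $\mathcal{P}(\cdot|s,a)$ is a probability distribution on $\mathcal{S}$), reward $r:\mathcal{S}\times\mathcal{A}\to\mathbb{R}$ and discount factor $\gamma\in(0,1)$. For a policy $\pi:\mathcal{S}\to\mathcal{A}$, $Q_\pi(s,a)=\mathbb{E}_\pi\big[\sum_{t=0}^\infty\gamma^tr(s_t,a_t)|s_0=s,a_0=a\big]$, where $s_{t+1}\sim\mathcal{P}(\cdot|s_t,a_t)$ and $a_t=\pi(s_t)$ for $t\ge1$. $Q^*(s,a)=\max_\pi Q_\pi(s,a)$. Notation: $\|x\|_\infty=\max_j|x(j)|$. $\max_{\mathcal{A}}(Q)(s)=\max_aQ(s,a)$. $\mathcal{T}_\gamma(Q)(s,a)=r(s,a)+\gamma\sum_{s'}\mathcal{P}(s'|s,a)\max_{a'}Q(s',a')$; $Q^*$ is the unique fixed point of $\mathcal{T}_\gamma$. $O(\cdot)$ hides an absolute constant factor. Subroutine $\mathrm{SAMPLE}(d,m)$, $d\in\mathbb{R}^{\mathcal{S}}$, $m\ge1$ integer: for each $(s,a)$ draw $m$ fresh i.i.d. samples $s_1,\dots,s_m\sim\mathcal{P}(\cdot|s,a)$ (independent of the past) and return the matrix $D(s,a)=\frac1m\sum_{j=1}^m d(s_j)$. It uses $|\mathcal{S}||\mathcal{A}|m$ samples. Algorithm $\mathrm{SAVID}(Q^0,n,\varepsilon,\delta,\gamma)$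 (with sequences $c_k,\beta_k$): set $\alpha=\ln(2|\mathcal{S}||\mathcal{A}|(n+1)/\delta)$, $T^{-1}=r$, $V^{-1}=0$, $\beta_0=0$. For $k=0,\dots,n$: $Q^k=(1-\beta_k)Q^0+\beta_kT^{k-1}$; $V^k=\max_{\mathcal{A}}(Q^k)$; $d^k=V^k-V^{k-1}$; $m_k=\max\{\lceil2\alpha c_k\|d^k\|_\infty^2/\varepsilon^2\rceil,1\}$; $D^k=\mathrm{SAMPLE}(d^k,m_k)$; $T^k=T^{k-1}+\gamma D^k$. Finally choose $\pi^n(s)\in\operatorname{argmax}_aQ^n(s,a)$ and output $(Q^n,T^n,\pi^n)$. Algorithm $\mathrm{SAVID}\textbf{+}(Q^0,\varepsilon,\delta,\gamma)$: for $i=0,1,2,\dots$ set $n_i=2^i$, $\delta_i=\delta/c_i$, and run $\mathrm{SAVID}(Q^0,n_i,\varepsilon,\delta_i,\gamma)$ afresh (with samples independent of earlier loops) to get $(Q^{n_i},T^{n_i},\pi^{n_i})$; stop at the first $i$ with $\|Q^{n_i}-T^{n_i}\|_\infty\le11\varepsilon$ and output $(Q^{n_i},T^{n_i},\pi^{n_i})$, denoted $(Q^N,T^N,\pi^N)$ with $N=n_i$ for this $i$. (In the claim the algorithm is called with $\varepsilon(1-\gamma)/24$ in place of $\varepsilon$.) Sample complexity is the total number of samples drawn over all loops until stopping; time complexity is the running time under the convention that each sample costs $O(1)$ time, so that it is of the same order as the sample complexity.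
   Formalization: The logarithmic factor L̃_γ is evaluated at min(ε,1) instead of ε, as the literal bound fails for some 1<ε≤1/(1−γ) (one state and action, r=1, ε=1/(1−γ)→∞); for ε≤1 it is unchanged. The O-constant is uniform over MDPs on any fixed ambient sets, e.g. the naturals. *)

theory Defs
  imports "HOL-Probability.Probability"
begin

section \<open>Finite discounted MDPs\<close>

text \<open>States and actions are finite carrier sets inside arbitrary types, not finite types:
  an absolute constant has to be chosen before \<open>|S|\<close> and \<open>|A|\<close>, and in HOL one cannot quantify
  over types inside a formula. (At type \<open>(nat, nat) mdp\<close> every pair of cardinalities occurs, so a
  constant obtained there serves all finite MDPs.) Values of tables outside the carriers are irrelevant.\<close>

record ('s, 'a) mdp =
  states :: "'s set"
  actions :: "'a set"
  trans_pmf :: "'s \<Rightarrow> 'a \<Rightarrow> 's pmf"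
  reward :: "'s \<Rightarrow> 'a \<Rightarrow> real"
  discount :: real

definition discounted_mdp :: "('s, 'a) mdp \<Rightarrow> bool" where
  "discounted_mdp M \<longleftrightarrow>
     finite (states M) \<and> states M \<noteq> {} \<and> finite (actions M) \<and> actions M \<noteq> {} \<and>
     (\<forall>s\<in>states M. \<forall>a\<in>actions M. set_pmf (trans_pmf M s a) \<subseteq> states M) \<and>
     0 < discount M \<and> discount M < 1"

definition norm_S :: "('s, 'a) mdp \<Rightarrow> ('s \<Rightarrow> real) \<Rightarrow> real" where
  "norm_S M d = Max ((\<lambda>s. \<bar>d s\<bar>) ` states M)"

definition norm_SA :: "('s, 'a) mdp \<Rightarrow> ('s \<Rightarrow> 'a \<Rightarrow> real) \<Rightarrow> real" where
  "norm_SA M Q = Max ((\<lambda>(s, a). \<bar>Q s a\<bar>) ` (states M \<times> actions M))"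

definition max_A :: "('s, 'a) mdp \<Rightarrow> ('s \<Rightarrow> 'a \<Rightarrow> real) \<Rightarrow> 's \<Rightarrow> real" where
  "max_A M Q s = Max (Q s ` actions M)"

definition bellman :: "('s, 'a) mdp \<Rightarrow> ('s \<Rightarrow> 'a \<Rightarrow> real) \<Rightarrow> 's \<Rightarrow> 'a \<Rightarrow> real" where
  "bellman M Q s a =
     reward M s a + discount M * (\<Sum>s'\<in>states M. pmf (trans_pmf M s a) s' * max_A M Q s')"

subsection \<open>Values of policies\<close>

text \<open>The law of the trajectory \<open>(s\<^sub>0, a\<^sub>0), (s\<^sub>1, a\<^sub>1), \<dots>\<close> started in \<open>(s, a)\<close> and following
  the policy from time 1 on, given by the Ionescu-Tulcea theorem.\<close>

definition step_kernel ::
  "('s, 'a) mdp \<Rightarrow> ('s \<Rightarrow> 'a) \<Rightarrow> 's \<Rightarrow> 'a \<Rightarrow> nat \<Rightarrow> (nat \<Rightarrow> 's \<times> 'a) \<Rightarrow> ('s \<times> 'a) measure" where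
  "step_kernel M \<pi> s a t h =
     (case t of
        0 \<Rightarrow> measure_pmf (return_pmf (s, a))
      | Suc u \<Rightarrow> measure_pmf (map_pmf (\<lambda>s'. (s', \<pi> s')) (trans_pmf M (fst (h u)) (snd (h u)))))"

definition trajectory ::
  "('s, 'a) mdp \<Rightarrow> ('s \<Rightarrow> 'a) \<Rightarrow> 's \<Rightarrow> 'a \<Rightarrow> (nat \<Rightarrow> 's \<times> 'a) measure" where
  "trajectory M \<pi> s a =
     projective_family.lim UNIV
       (Ionescu_Tulcea.CI (step_kernel M \<pi> s a) (\<lambda>_. count_space UNIV)) (\<lambda>_. count_space UNIV)"

lemma step_kernel_Ionescu_Tulcea:
  "Ionescu_Tulcea (step_kernel M \<pi> s a) (\<lambda>_. count_space UNIV)"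
proof (rule Ionescu_Tulcea.intro)
  show "step_kernel M \<pi> s a i \<in>
          measurable (Pi\<^sub>M {0..<i} (\<lambda>_. count_space UNIV)) (subprob_algebra (count_space UNIV))" for i
  proof (cases i)
    case 0
    then show ?thesis
      by (simp add: step_kernel_def[abs_def] space_subprob_algebra measure_pmf.subprob_space_axioms)
  next
    case (Suc u)
    let ?f = "\<lambda>p. measure_pmf (map_pmf (\<lambda>s'. (s', \<pi> s')) (trans_pmf M (fst p) (snd p)))"
    have "?f \<in> measurable (count_space UNIV) (subprob_algebra (count_space UNIV))"
      by (auto simp: space_subprob_algebra measure_pmf.subprob_space_axioms)
    moreover have "(\<lambda>h. h u) \<in> measurable (Pi\<^sub>M {0..<i} (\<lambda>_. count_space UNIV)) (count_space UNIV)"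
      using Suc by (intro measurable_component_singleton) auto
    ultimately have "(\<lambda>h. ?f (h u)) \<in>
        measurable (Pi\<^sub>M {0..<i} (\<lambda>_. count_space UNIV)) (subprob_algebra (count_space UNIV))"
      by (rule measurable_compose[rotated])
    then show ?thesis using Suc by (simp add: step_kernel_def[abs_def])
  qed
  show "prob_space (step_kernel M \<pi> s a i x)"
    if "x \<in> space (Pi\<^sub>M {0..<i} (\<lambda>_. count_space UNIV))" for i x
    by (cases i) (simp_all add: step_kernel_def measure_pmf.prob_space_axioms)
qed

definition policy_value :: "('s, 'a) mdp \<Rightarrow> ('s \<Rightarrow> 'a) \<Rightarrow> 's \<Rightarrow> 'a \<Rightarrow> real" where
  "policy_value M \<pi> s a =
     (\<integral>\<omega>. (\<Sum>t. discount M ^ t * reward M (fst (\<omega> t)) (snd (\<omega> t))) \<partial>trajectory M \<pi> s a)"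

definition opt_value :: "('s, 'a) mdp \<Rightarrow> 's \<Rightarrow> 'a \<Rightarrow> real" where
  "opt_value M s a = Max ((\<lambda>\<pi>. policy_value M \<pi> s a) ` (states M \<rightarrow>\<^sub>E actions M))"

section \<open>The algorithms\<close>

text \<open>Running time is counted in unit-cost steps: one step per sample drawn and one step per
  arithmetic operation, comparison or table entry written. In the iteration below, the table
  operations are charged \<open>|S||A|\<close> for each of \<open>Q\<^sup>k\<close>, \<open>V\<^sup>k\<close>, \<open>T\<^sup>k\<close>; \<open>|S|\<close> for each of \<open>d\<^sup>k\<close>
  and its norm; 1 for \<open>m\<^sub>k\<close>; and SAMPLE is charged \<open>|S||A|m\<close> for the draws, \<open>|S||A|m\<close> for the
  additions and \<open>|S||A|\<close> for the divisions.\<close>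

definition SAMPLE ::
  "('s, 'a) mdp \<Rightarrow> ('s \<Rightarrow> real) \<Rightarrow> nat \<Rightarrow> ('s \<Rightarrow> 'a \<Rightarrow> real) pmf" where
  "SAMPLE M d m =
     map_pmf (\<lambda>X s a. (\<Sum>j<m. d (X (s, a, j))) / real m)
       (Pi_pmf (states M \<times> actions M \<times> {..<m}) undefined (\<lambda>(s, a, j). trans_pmf M s a))"

definition n_SA :: "('s, 'a) mdp \<Rightarrow> nat" where
  "n_SA M = card (states M) * card (actions M)"

text \<open>Before iteration \<open>k\<close> the components \<open>cur_T\<close> and \<open>cur_V\<close> hold \<open>T\<^sup>k\<^sup>-\<^sup>1\<close> and \<open>V\<^sup>k\<^sup>-\<^sup>1\<close>.\<close>

record ('s, 'a) savid_state =
  cur_Q :: "'s \<Rightarrow> 'a \<Rightarrow> real"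
  cur_T :: "'s \<Rightarrow> 'a \<Rightarrow> real"
  cur_V :: "'s \<Rightarrow> real"
  n_samples :: nat
  n_steps :: nat

definition savid_init ::
  "('s, 'a) mdp \<Rightarrow> ('s \<Rightarrow> 'a \<Rightarrow> real) \<Rightarrow> ('s, 'a) savid_state" where
  "savid_init M Q0 =
     \<lparr>cur_Q = Q0, cur_T = reward M, cur_V = (\<lambda>_. 0),
      n_samples = 0, n_steps = 1 + n_SA M + card (states M)\<rparr>"

definition savid_step ::
  "('s, 'a) mdp \<Rightarrow> (nat \<Rightarrow> real) \<Rightarrow> (nat \<Rightarrow> real) \<Rightarrow> ('s \<Rightarrow> 'a \<Rightarrow> real) \<Rightarrow> real \<Rightarrow> real \<Rightarrow>
   nat \<Rightarrow> ('s, 'a) savid_state \<Rightarrow> ('s, 'a) savid_state pmf" where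
  "savid_step M c \<beta> Q0 \<epsilon> \<alpha> k st =
     (let Q = (\<lambda>s a. (1 - \<beta> k) * Q0 s a + \<beta> k * cur_T st s a);
          V = max_A M Q;
          d = (\<lambda>s. V s - cur_V st s);
          m = max (nat \<lceil>2 * \<alpha> * c k * (norm_S M d)\<^sup>2 / \<epsilon>\<^sup>2\<rceil>) 1
      in map_pmf
           (\<lambda>D. \<lparr>cur_Q = Q, cur_T = (\<lambda>s a. cur_T st s a + discount M * D s a), cur_V = V,
                 n_samples = n_samples st + n_SA M * m,
                 n_steps = n_steps st + 3 * n_SA M + 2 * card (states M) + 1
                             + (2 * n_SA M * m + n_SA M)\<rparr>)
           (SAMPLE M d m))"

text \<open>State after iterations \<open>0, \<dots>, k - 1\<close>.\<close>

primrec savid_iter ::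
  "('s, 'a) mdp \<Rightarrow> (nat \<Rightarrow> real) \<Rightarrow> (nat \<Rightarrow> real) \<Rightarrow> ('s \<Rightarrow> 'a \<Rightarrow> real) \<Rightarrow> real \<Rightarrow> real \<Rightarrow>
   nat \<Rightarrow> ('s, 'a) savid_state pmf" where
  "savid_iter M c \<beta> Q0 \<epsilon> \<alpha> 0 = return_pmf (savid_init M Q0)"
| "savid_iter M c \<beta> Q0 \<epsilon> \<alpha> (Suc k) =
     bind_pmf (savid_iter M c \<beta> Q0 \<epsilon> \<alpha> k) (savid_step M c \<beta> Q0 \<epsilon> \<alpha> k)"

text \<open>A tie-breaking rule for the choice of an element of \<open>argmax\<^sub>a Q(s, a)\<close>.\<close>

definition argmax_rule ::
  "('s, 'a) mdp \<Rightarrow> (('s \<Rightarrow> 'a \<Rightarrow> real) \<Rightarrow> 's \<Rightarrow> 'a) \<Rightarrow> bool" where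
  "argmax_rule M sel \<longleftrightarrow>
     (\<forall>Q. \<forall>s\<in>states M. sel Q s \<in> actions M \<and> (\<forall>a\<in>actions M. Q s a \<le> Q s (sel Q s)))"

record ('s, 'a) savid_output =
  out_Q :: "'s \<Rightarrow> 'a \<Rightarrow> real"
  out_T :: "'s \<Rightarrow> 'a \<Rightarrow> real"
  out_policy :: "'s \<Rightarrow> 'a"
  samples :: nat
  run_time :: nat

definition SAVID ::
  "('s, 'a) mdp \<Rightarrow> (('s \<Rightarrow> 'a \<Rightarrow> real) \<Rightarrow> 's \<Rightarrow> 'a) \<Rightarrow> (nat \<Rightarrow> real) \<Rightarrow> (nat \<Rightarrow> real) \<Rightarrow>
   ('s \<Rightarrow> 'a \<Rightarrow> real) \<Rightarrow> nat \<Rightarrow> real \<Rightarrow> real \<Rightarrow> ('s, 'a) savid_output pmf" where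
  "SAVID M sel c \<beta> Q0 n \<epsilon> \<delta> =
     (let \<alpha> = ln (2 * real (n_SA M) * (real n + 1) / \<delta>)
      in map_pmf
           (\<lambda>st. \<lparr>out_Q = cur_Q st, out_T = cur_T st, out_policy = sel (cur_Q st),
                  samples = n_samples st, run_time = n_steps st + n_SA M\<rparr>)
           (savid_iter M c \<beta> Q0 \<epsilon> \<alpha> (Suc n)))"

text \<open>The loop of SAVID+ from index \<open>i\<close> on, where \<open>u\<close> samples and \<open>t\<close> steps have been spent in
  the earlier loops. A subprobability mass function is needed because termination is not built
  in: the missing mass is the probability of running forever. The stopping test is charged
  \<open>|S||A|\<close> steps, and the computation of \<open>n\<^sub>i\<close> and \<open>\<delta>\<^sub>i\<close> one step each.\<close>

partial_function (spmf) savid_plus_from ::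
  "('s, 'a) mdp \<Rightarrow> (('s \<Rightarrow> 'a \<Rightarrow> real) \<Rightarrow> 's \<Rightarrow> 'a) \<Rightarrow> (nat \<Rightarrow> real) \<Rightarrow> (nat \<Rightarrow> real) \<Rightarrow>
   ('s \<Rightarrow> 'a \<Rightarrow> real) \<Rightarrow> real \<Rightarrow> real \<Rightarrow> nat \<Rightarrow> nat \<Rightarrow> nat \<Rightarrow> ('s, 'a) savid_output spmf" where
  "savid_plus_from M sel c \<beta> Q0 \<epsilon> \<delta> i u t =
     bind_spmf (spmf_of_pmf (SAVID M sel c \<beta> Q0 (2 ^ i) \<epsilon> (\<delta> / c i)))
       (\<lambda>out.
          let u' = u + samples out; t' = t + run_time out + n_SA M + 2
          in if norm_SA M (\<lambda>s a. out_Q out s a - out_T out s a) \<le> 11 * \<epsilon>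
             then return_spmf (out\<lparr>samples := u', run_time := t'\<rparr>)
             else savid_plus_from M sel c \<beta> Q0 \<epsilon> \<delta> (Suc i) u' t')"

definition SAVID_plus ::
  "('s, 'a) mdp \<Rightarrow> (('s \<Rightarrow> 'a \<Rightarrow> real) \<Rightarrow> 's \<Rightarrow> 'a) \<Rightarrow> (nat \<Rightarrow> real) \<Rightarrow> (nat \<Rightarrow> real) \<Rightarrow>
   ('s \<Rightarrow> 'a \<Rightarrow> real) \<Rightarrow> real \<Rightarrow> real \<Rightarrow> ('s, 'a) savid_output spmf" where
  "SAVID_plus M sel c \<beta> Q0 \<epsilon> \<delta> = savid_plus_from M sel c \<beta> Q0 \<epsilon> \<delta> 0 0 0"

definition c_seq :: "nat \<Rightarrow> real" where
  "c_seq k = 5 * (real k + 2) * (ln (real k + 2))\<^sup>2"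

definition \<beta>_seq :: "nat \<Rightarrow> real" where
  "\<beta>_seq k = real k / (real k + 2)"

definition L_tilde :: "('s, 'a) mdp \<Rightarrow> real \<Rightarrow> real \<Rightarrow> real" where
  "L_tilde M \<epsilon> \<delta> =
     ln (2 * real (n_SA M) / ((1 - discount M) * \<epsilon> * \<delta>)) * ln (2 / ((1 - discount M) * \<epsilon>)) ^ 4"

text \<open>The logarithmic factor is evaluated at \<open>min \<epsilon> 1\<close>; for \<open>\<epsilon> \<le> 1\<close> this is \<open>L_tilde M \<epsilon> \<delta>\<close>.
  With \<open>\<epsilon>\<close> itself no absolute constant exists for \<open>1 < \<epsilon> \<le> 1 / (1 - \<gamma>)\<close>. Take one state, one
  action, reward 1, \<open>\<gamma> = 1 - 1 / L\<close>, \<open>\<epsilon> = L\<close> and \<open>\<delta> = 1 / 2\<close>. Then \<open>L_tilde M \<epsilon> \<delta>\<close> does not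
  depend on \<open>L\<close> and the bound would be of order \<open>L\<^sup>2\<close>, whereas the algorithm, which is
  deterministic here, stops only once \<open>n \<ge> 13 L / 8\<close> and by then has drawn at least of the order
  of \<open>L\<^sup>2 (ln L)\<^sup>3\<close> samples.\<close>

definition complexity_bound :: "('s, 'a) mdp \<Rightarrow> real \<Rightarrow> real \<Rightarrow> real" where
  "complexity_bound M \<epsilon> \<delta> =
     L_tilde M (min \<epsilon> 1) \<delta> *
     (real (n_SA M) * (norm_SA M (opt_value M))\<^sup>2 / ((1 - discount M)\<^sup>2 * \<epsilon>\<^sup>2))"

end

theory Submission
  imports Defs
begin

text \<open>In each run, \<open>T\<^sup>k\<close> differs from the Bellman image of \<open>Q\<^sup>k\<close> by a sum of martingale differences
  whose conditional variance proxies add up to at most \<open>\<epsilon>\<^sup>2 / (2 \<alpha>)\<close>, because the batch sizes are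
  proportional to \<open>c\<^sub>k \<parallel>d\<^sup>k\<parallel>\<^sup>2\<close> and \<open>\<Sum> 1 / c\<^sub>k \<le> 1\<close>. Hoeffding's lemma and a union bound make all these
  errors at most \<open>\<epsilon>\<close>. On that event the anchored iteration satisfies \<open>\<parallel>d\<^sup>k\<parallel> = O(\<parallel>Q\<^sup>*\<parallel> / k + \<epsilon>)\<close>: a
  sampled increment is never larger than the true one, so the errors enter only through the
  \<open>O(1 / k\<^sup>2)\<close> change of the anchoring weights. This bounds both the batch sizes and the residual,
  so the loop stops at the latest when \<open>2\<^sup>i \<ge> \<parallel>Q\<^sup>*\<parallel> / \<epsilon>\<close>. A small residual \<open>\<parallel>Q - \<T>(Q)\<parallel>\<close> bounds the
  distance of \<open>Q\<close> both to \<open>Q\<^sup>*\<close> and to the value of its greedy policy, by contraction.\<close>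

section \<open>Policy values\<close>

text \<open>The batch sizes depend on the random past, so the samples of a run are not independent.
  Each batch is, however, at least proportional to the squared increment that it averages, which
  gives its variance proxy a deterministic bound and lets a plain induction on exponential moments
  suffice. The analysis of a run uses of \<gamma> only that it is at most 1: the O(1/k) decay comes
  from the anchor weights alone, and the horizon 1/(1-\<gamma>) is paid when a residual is turned
  into a distance. The stopping test is a certificate: |Q-T| <= 11\<epsilon> and an error of at most
  \<epsilon> give a Bellman residual of at most 12\<epsilon>, and 2/(1-\<gamma>) times this is the
  requested accuracy after the rescaling by (1-\<gamma>)/24. Stopping early therefore does no harm.
  The sequence c serves twice through sum 1/c <= 1: it caps the variance of a run and the total
  failure probability of the loops. The last loop index I has R <= 2^I \<epsilon> <= 2R with R the
  norm of Q*. The lower bound forces the stop; the upper one makes the \<epsilon>-part of the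
  increments cost no more than the decaying part.\<close>

primrec marginal ::
  "('s, 'a) mdp \<Rightarrow> ('s \<Rightarrow> 'a) \<Rightarrow> 's \<Rightarrow> 'a \<Rightarrow> nat \<Rightarrow> ('s \<times> 'a) pmf" where
  "marginal M \<pi> s a 0 = return_pmf (s, a)"
| "marginal M \<pi> s a (Suc t) =
     bind_pmf (marginal M \<pi> s a t) (\<lambda>(x, b). map_pmf (\<lambda>s'. (s', \<pi> s')) (trans_pmf M x b))"

text \<open>\<open>marginal\<close> appends steps at the end, as the kernels do. The Bellman
  equation needs the first step split off instead; time homogeneity lets the chain restart at
  \<open>(s', \<pi> s')\<close>.\<close>

lemma marginal_Suc_start:
  "marginal M \<pi> s a (Suc t) = bind_pmf (trans_pmf M s a) (\<lambda>s'. marginal M \<pi> s' (\<pi> s') t)"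
  by (induction t) (simp_all add: bind_return_pmf map_pmf_def bind_assoc_pmf)

text \<open>Restricted to times up to t, the projective limit is a finite composition of kernels,
  and each kernel looks only at the last coordinate. Integrating out that coordinate replaces f by
  another function of the previous one, hence the induction with f arbitrary.\<close>

lemma nn_integral_trajectory:
  fixes f :: "'s \<times> 'a \<Rightarrow> ennreal"
  shows "(\<integral>\<^sup>+\<omega>. f (\<omega> t) \<partial>trajectory M \<pi> s a) = (\<integral>\<^sup>+x. f x \<partial>marginal M \<pi> s a t)"
proof -
  interpret IT: Ionescu_Tulcea "step_kernel M \<pi> s a" "\<lambda>_. count_space UNIV"
    by (rule step_kernel_Ionescu_Tulcea)
  let ?PM = "\<lambda>J::nat set. Pi\<^sub>M J (\<lambda>_. count_space (UNIV :: ('s \<times> 'a) set))"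
  have in0: "(\<lambda>_. undefined) \<in> space (?PM {0..<0})"
    by (simp add: space_PiM PiE_iff)
  have restr: "(\<lambda>\<omega>. restrict \<omega> {0..<Suc n}) \<in> measurable (?PM UNIV) (?PM {0..<Suc n})" for n
    by (rule measurable_restrict_subset) simp
  have meas: "(\<lambda>\<omega>. g (\<omega> u)) \<in> borel_measurable (?PM J)" if "u \<in> J"
    for u J and g :: "'s \<times> 'a \<Rightarrow> ennreal"
    by (rule measurable_compose[OF measurable_component_singleton[OF that]]) simp
  have C: "(\<integral>\<^sup>+\<omega>. f (\<omega> t) \<partial>IT.C 0 (Suc t) (\<lambda>_. undefined)) = (\<integral>\<^sup>+x. f x \<partial>marginal M \<pi> s a t)"
    for f t
  proof (induction t arbitrary: f)
    case 0
    have "(\<integral>\<^sup>+\<omega>. f (\<omega> 0) \<partial>IT.C 0 (Suc 0) (\<lambda>_. undefined)) = (\<integral>\<^sup>+\<omega>. f (\<omega> 0) \<partial>IT.eP 0 (\<lambda>_. undefined))"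
      using in0 bind_return[OF IT.measurable_eP in0] by simp
    also have "\<dots> = f (s, a)"
      using in0 by (subst IT.nn_integral_eP) (auto simp: step_kernel_def intro!: meas)
    finally show ?case by simp
  next
    case (Suc t)
    let ?g = "\<lambda>p. \<integral>\<^sup>+y. f y \<partial>map_pmf (\<lambda>s'. (s', \<pi> s')) (trans_pmf M (fst p) (snd p))"
    have sp: "space (IT.C 0 (Suc t) (\<lambda>_. undefined)) = space (?PM {0..<Suc t})"
      using in0 by (simp add: IT.space_C del: IT.C.simps)
    have st: "sets (IT.C 0 (Suc t) (\<lambda>_. undefined)) = sets (?PM {0..<Suc t})"
      using IT.sets_C[OF in0, of "Suc t"] by (simp del: IT.C.simps)
    have "(\<integral>\<^sup>+\<omega>. f (\<omega> (Suc t)) \<partial>IT.C 0 (Suc (Suc t)) (\<lambda>_. undefined)) =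
      (\<integral>\<^sup>+\<omega>. \<integral>\<^sup>+\<omega>'. f (\<omega>' (Suc t)) \<partial>IT.eP (Suc t) \<omega> \<partial>IT.C 0 (Suc t) (\<lambda>_. undefined))"
      unfolding IT.C.simps(2)[of 0 "Suc t"] add_0
      by (rule nn_integral_bind[where B="?PM {0..<Suc (Suc t)}"])
         (auto intro!: meas simp: measurable_cong_sets[OF st refl] simp del: IT.C.simps)
    also have "\<dots> = (\<integral>\<^sup>+\<omega>. ?g (\<omega> t) \<partial>IT.C 0 (Suc t) (\<lambda>_. undefined))"
      by (rule nn_integral_cong, subst IT.nn_integral_eP)
         (auto intro!: meas simp: sp step_kernel_def simp del: IT.C.simps)
    also have "\<dots> = (\<integral>\<^sup>+x. ?g x \<partial>marginal M \<pi> s a t)"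
      by (rule Suc.IH)
    finally show ?case by (simp add: case_prod_beta')
  qed
  have "(\<integral>\<^sup>+\<omega>. f (\<omega> t) \<partial>trajectory M \<pi> s a)
      = (\<integral>\<^sup>+\<omega>. f (restrict \<omega> {0..<Suc t} t) \<partial>trajectory M \<pi> s a)"
    by simp
  also have "\<dots> = (\<integral>\<^sup>+\<omega>. f (\<omega> t) \<partial>distr (trajectory M \<pi> s a) (?PM {0..<Suc t}) (\<lambda>\<omega>. restrict \<omega> {0..<Suc t}))"
    unfolding trajectory_def
    by (rule nn_integral_distr[symmetric])
       (use restr in \<open>auto intro!: meas simp: measurable_cong_sets[OF IT.PF.sets_lim refl] simp del: restrict_apply\<close>)
  also have "\<dots> = (\<integral>\<^sup>+\<omega>. f (\<omega> t) \<partial>IT.CI {0..<Suc t})"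
    unfolding trajectory_def by (subst IT.distr_lim) simp_all
  \<comment> \<open>\<open>CI\<close> composes kernels up to the shortest initial segment covering
    the index set and then restricts; for an initial segment the restriction changes
    nothing.\<close>
  also have "IT.up_to {0..<Suc t} = Suc t"
    by (intro antisym) (auto simp: IT.up_to_iff_Ico intro!: Suc_leI IT.up_to_less)
  then have "IT.CI {0..<Suc t} = IT.C 0 (Suc t) (\<lambda>_. undefined)"
    unfolding IT.CI_def using IT.distr_C[OF order_refl in0, of "Suc t"] by simp
  finally show ?thesis by (simp add: C del: IT.C.simps)
qed


lemma sets_trajectory:
  "sets (trajectory M \<pi> s a) = sets (Pi\<^sub>M UNIV (\<lambda>_. count_space (UNIV :: ('s \<times> 'a) set)))"
  for M :: "('s, 'a) mdp"
proof -
  interpret IT: Ionescu_Tulcea "step_kernel M \<pi> s a" "\<lambda>_. count_space UNIV"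
    by (rule step_kernel_Ionescu_Tulcea)
  show ?thesis unfolding trajectory_def by (rule IT.PF.sets_lim)
qed

lemma measurable_trajectory_component:
  fixes M :: "('s, 'a) mdp" and N :: "'b measure"
  assumes "f \<in> measurable (count_space UNIV) N"
  shows "(\<lambda>\<omega>. f (\<omega> t)) \<in> measurable (trajectory M \<pi> s a) N"
  by (rule measurable_compose[OF _ assms])
     (simp add: measurable_cong_sets[OF sets_trajectory refl])

lemma distr_trajectory:
  "distr (trajectory M \<pi> s a) (count_space UNIV) (\<lambda>\<omega>. \<omega> t) = measure_pmf (marginal M \<pi> s a t)"
proof (rule measure_eqI)
  fix X assume "X \<in> sets (distr (trajectory M \<pi> s a) (count_space UNIV) (\<lambda>\<omega>. \<omega> t))"
  have "emeasure (distr (trajectory M \<pi> s a) (count_space UNIV) (\<lambda>\<omega>. \<omega> t)) X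
      = (\<integral>\<^sup>+\<omega>. indicator X (\<omega> t) \<partial>trajectory M \<pi> s a)"
    by (subst nn_integral_indicator[symmetric], simp, subst nn_integral_distr)
       (auto intro: measurable_trajectory_component[where f="\<lambda>x. x"])
  then show "emeasure (distr (trajectory M \<pi> s a) (count_space UNIV) (\<lambda>\<omega>. \<omega> t)) X
      = emeasure (measure_pmf (marginal M \<pi> s a t)) X"
    by (simp add: nn_integral_trajectory)
qed simp

section \<open>Bellman equations, optimal policies and the error of greedy policies\<close>

locale unit_reward_mdp =
  fixes M :: "('s, 'a) mdp"
  assumes mdp: "discounted_mdp M"
    and reward_range: "\<And>s a. s \<in> states M \<Longrightarrow> a \<in> actions M \<Longrightarrow> 0 \<le> reward M s a \<and> reward M s a \<le> 1"
begin

abbreviation "S \<equiv> states M"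
abbreviation "A \<equiv> actions M"
abbreviation "\<gamma> \<equiv> discount M"
abbreviation "P \<equiv> trans_pmf M"

lemma finite_S [simp, intro]: "finite S" and S_ne [simp]: "S \<noteq> {}"
  and finite_A [simp, intro]: "finite A" and A_ne [simp]: "A \<noteq> {}"
  and discount_pos: "0 < \<gamma>" and discount_less_1: "\<gamma> < 1"
  using mdp by (auto simp: discounted_mdp_def)

lemma card_S_le: "card S \<le> n_SA M" and n_SA_pos: "0 < n_SA M"
proof -
  have "0 < card S" "0 < card A" by (simp_all add: card_gt_0_iff)
  then show "card S \<le> n_SA M" "0 < n_SA M" by (simp_all add: n_SA_def)
qed

lemma real_n_SA_ge_1: "1 \<le> real (n_SA M)"
  using n_SA_pos by linarith

lemma set_trans: "s \<in> S \<Longrightarrow> a \<in> A \<Longrightarrow> set_pmf (P s a) \<subseteq> S"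
  using mdp by (auto simp: discounted_mdp_def)

lemma sum_trans [simp]: "s \<in> S \<Longrightarrow> a \<in> A \<Longrightarrow> (\<Sum>s'\<in>S. pmf (P s a) s') = 1"
  using set_trans by (intro sum_pmf_eq_1) auto

lemma set_marginal:
  assumes "\<pi> \<in> S \<rightarrow> A" "s \<in> S" "a \<in> A"
  shows "set_pmf (marginal M \<pi> s a t) \<subseteq> S \<times> A"
proof (induction t)
  case (Suc t)
  then show ?case using set_trans assms by fastforce
qed (use assms in auto)

text \<open>Expectation and infinite sum are exchanged by domination with the geometric series.
  Rewards are bounded only on the carriers, so this needs that almost every path stays in them at
  all times.\<close>

lemma policy_value_series:
  assumes "\<pi> \<in> S \<rightarrow> A" "s \<in> S" "a \<in> A"
  shows "policy_value M \<pi> s a =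
    (\<Sum>t. \<gamma> ^ t * measure_pmf.expectation (marginal M \<pi> s a t) (\<lambda>(x, b). reward M x b))"
proof -
  let ?r = "\<lambda>(x, b). reward M x b" and ?T = "trajectory M \<pi> s a"
  note comp = measurable_trajectory_component[of _ _ _ M \<pi> s a]
  have int: "(\<integral>\<omega>. f (\<omega> t) \<partial>?T) = measure_pmf.expectation (marginal M \<pi> s a t) f"
    for t and f :: "'s \<times> 'a \<Rightarrow> real"
    unfolding distr_trajectory[symmetric]
    by (rule integral_distr[symmetric]) (auto intro: comp[where f="\<lambda>x. x"])
  have integrable: "integrable ?T (\<lambda>\<omega>. f (\<omega> t))" for t and f :: "'s \<times> 'a \<Rightarrow> real"
  proof -
    have "integrable (measure_pmf (marginal M \<pi> s a t)) f"
      by (intro integrable_measure_pmf_finite finite_subset[OF set_marginal[OF assms]]) auto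
    then show ?thesis
      unfolding distr_trajectory[symmetric]
      by (rule integrable_distr[rotated]) (auto intro: comp[where f="\<lambda>x. x"])
  qed
  have AE_in: "AE \<omega> in ?T. \<omega> t \<in> S \<times> A" for t
  proof -
    have "AE x in distr ?T (count_space UNIV) (\<lambda>\<omega>. \<omega> t). x \<in> S \<times> A"
      unfolding distr_trajectory using set_marginal[OF assms] by (auto simp: AE_measure_pmf_iff)
    then show ?thesis
      by (subst (asm) AE_distr_iff) (auto intro: comp[where f="\<lambda>x. x"])
  qed
  have sum: "summable (\<lambda>t. \<gamma> ^ t * c t)" if "\<And>t. \<bar>c t\<bar> \<le> 1" for c :: "nat \<Rightarrow> real"
    by (rule summable_comparison_test'[OF summable_geometric[of \<gamma>], of 0])
       (use that discount_pos discount_less_1 in \<open>auto simp: abs_mult mult_left_le\<close>)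
  have "AE \<omega> in ?T. \<forall>t. \<omega> t \<in> S \<times> A"
    using AE_in by (simp add: AE_all_countable)
  then have "AE \<omega> in ?T. summable (\<lambda>t. norm (\<gamma> ^ t * ?r (\<omega> t)))"
  proof eventually_elim
    case (elim \<omega>)
    have "summable (\<lambda>t. \<gamma> ^ t * \<bar>?r (\<omega> t)\<bar>)"
      using elim reward_range by (intro sum) (auto simp: mem_Times_iff case_prod_beta')
    then show ?case using discount_pos by (simp add: abs_mult)
  qed
  moreover have "summable (\<lambda>t. \<integral>\<omega>. norm (\<gamma> ^ t * ?r (\<omega> t)) \<partial>?T)"
  proof -
    have "\<bar>measure_pmf.expectation (marginal M \<pi> s a t) (\<lambda>x. \<bar>?r x\<bar>)\<bar> \<le> 1" for t
      using set_marginal[OF assms, of t] reward_range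
      by (auto intro!: measure_pmf.integral_le_const AE_pmfI integrable_measure_pmf_finite
            finite_subset[OF set_marginal[OF assms]] simp: abs_le_iff split: prod.splits)
    from sum[OF this] show ?thesis
      using discount_pos by (simp add: abs_mult int[where f="\<lambda>x. \<bar>?r x\<bar>"])
  qed
  ultimately have "(\<integral>\<omega>. (\<Sum>t. \<gamma> ^ t * ?r (\<omega> t)) \<partial>?T) = (\<Sum>t. \<integral>\<omega>. \<gamma> ^ t * ?r (\<omega> t) \<partial>?T)"
    by (intro integral_suminf integrable_mult_right) (auto intro: integrable)
  then show ?thesis
    by (simp add: policy_value_def case_prod_beta' int[where f="\<lambda>x. reward M (fst x) (snd x)"])
qed

text \<open>The term t = 0 of the series is split off and the others are conditioned on the first
  transition; the sum over \<open>S\<close> is finite and commutes with the series.\<close>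

lemma policy_value_Bellman:
  assumes "\<pi> \<in> S \<rightarrow> A" "s \<in> S" "a \<in> A"
  shows "policy_value M \<pi> s a = reward M s a + \<gamma> * (\<Sum>s'\<in>S. pmf (P s a) s' * policy_value M \<pi> s' (\<pi> s'))"
proof -
  let ?e = "\<lambda>s a t. measure_pmf.expectation (marginal M \<pi> s a t) (\<lambda>(x, b). reward M x b)"
  have fin: "finite (set_pmf (marginal M \<pi> s a t))" if "s \<in> S" "a \<in> A" for s a t
    by (rule finite_subset[OF set_marginal[OF assms(1) that]]) auto
  have e_bound: "\<bar>?e s a t\<bar> \<le> 1" if "s \<in> S" "a \<in> A" for s a t
  proof -
    have "\<bar>reward M x b\<bar> \<le> 1" if "(x, b) \<in> set_pmf (marginal M \<pi> s a t)" for x b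
      using that set_marginal[OF assms(1) \<open>s \<in> S\<close> \<open>a \<in> A\<close>, of t] reward_range[of x b] by auto
    then have "measure_pmf.expectation (marginal M \<pi> s a t) (\<lambda>x. \<bar>case x of (x, b) \<Rightarrow> reward M x b\<bar>) \<le> 1"
      by (intro measure_pmf.integral_le_const integrable_measure_pmf_finite fin that AE_pmfI) auto
    then show ?thesis
      using integral_abs_bound[of "measure_pmf (marginal M \<pi> s a t)" "\<lambda>(x, b). reward M x b"] by linarith
  qed
  have summ: "summable (\<lambda>t. \<gamma> ^ t * ?e s a t)" if "s \<in> S" "a \<in> A" for s a
    by (rule summable_comparison_test'[OF summable_geometric[of \<gamma>], of 0])
       (use e_bound[OF that] discount_pos discount_less_1 in \<open>auto simp: abs_mult mult_left_le\<close>)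
  have step: "?e s a (Suc t) = (\<Sum>s'\<in>S. pmf (P s a) s' * ?e s' (\<pi> s') t)" for t
    unfolding marginal_Suc_start
    using assms set_trans[of s a] fin
    by (subst pmf_expectation_bind[of S]) (auto simp: Pi_iff)
  have pi: "\<pi> s' \<in> A" if "s' \<in> S" for s' using assms that by auto
  have "policy_value M \<pi> s a = (\<Sum>t. \<gamma> ^ t * ?e s a t)"
    by (rule policy_value_series[OF assms])
  also have "\<dots> = reward M s a + (\<Sum>t. \<gamma> ^ Suc t * ?e s a (Suc t))"
    using suminf_split_head[OF summ[OF assms(2,3)]] by simp
  also have "(\<lambda>t. \<gamma> ^ Suc t * ?e s a (Suc t)) =
      (\<lambda>t. \<gamma> * (\<Sum>s'\<in>S. pmf (P s a) s' * (\<gamma> ^ t * ?e s' (\<pi> s') t)))"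
    unfolding step by (simp add: sum_distrib_left mult_ac)
  also have "(\<Sum>t. \<gamma> * (\<Sum>s'\<in>S. pmf (P s a) s' * (\<gamma> ^ t * ?e s' (\<pi> s') t))) =
      \<gamma> * (\<Sum>s'\<in>S. pmf (P s a) s' * (\<Sum>t. \<gamma> ^ t * ?e s' (\<pi> s') t))"
  proof -
    have s1: "summable (\<lambda>t. pmf (P s a) s' * (\<gamma> ^ t * ?e s' (\<pi> s') t))" if "s' \<in> S" for s'
      using summ[OF that pi[OF that]] by (rule summable_mult)
    then show ?thesis
      using summ pi
      by (simp add: suminf_mult summable_sum suminf_sum[of S] cong: sum.cong)
  qed
  also have "\<dots> = \<gamma> * (\<Sum>s'\<in>S. pmf (P s a) s' * policy_value M \<pi> s' (\<pi> s'))"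
    using pi by (auto intro!: arg_cong2[of _ _ _ _ "(*)"] sum.cong simp: policy_value_series[OF assms(1)])
  finally show ?thesis .
qed


text \<open>Apply \<open>step\<close> to the maximum B of W over the carriers: B <= e + \<gamma> B.
  This takes the place of Banach's fixed point theorem throughout, and only values on the carriers
  enter.\<close>

lemma discounted_le:
  assumes step: "\<And>B s a. (\<And>s a. s \<in> S \<Longrightarrow> a \<in> A \<Longrightarrow> W s a \<le> B) \<Longrightarrow> s \<in> S \<Longrightarrow> a \<in> A \<Longrightarrow> W s a \<le> e + \<gamma> * B"
    and "s \<in> S" "a \<in> A"
  shows "W s a \<le> e / (1 - \<gamma>)"
proof -
  let ?B = "Max ((\<lambda>(s, a). W s a) ` (S \<times> A))"
  have le: "W s a \<le> ?B" if "s \<in> S" "a \<in> A" for s a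
    using that by (intro Max_ge) auto
  have "?B \<in> (\<lambda>(s, a). W s a) ` (S \<times> A)"
    by (intro Max_in) auto
  then obtain p where "p \<in> S \<times> A" "?B = (\<lambda>(s, a). W s a) p" by blast
  then obtain s' a' where "s' \<in> S" "a' \<in> A" "?B = W s' a'" by (cases p) auto
  then have "?B \<le> e + \<gamma> * ?B"
    using step[OF le, of s' a'] by simp
  then have "?B \<le> e / (1 - \<gamma>)"
    using discount_less_1 by (simp add: field_simps)
  with le[OF assms(2,3)] show ?thesis by (rule order_trans)
qed

lemma norm_SA_le_iff: "norm_SA M Q \<le> b \<longleftrightarrow> (\<forall>s\<in>S. \<forall>a\<in>A. \<bar>Q s a\<bar> \<le> b)"
  unfolding norm_SA_def by (subst Max_le_iff) auto

lemma norm_SA_ge: "s \<in> S \<Longrightarrow> a \<in> A \<Longrightarrow> \<bar>Q s a\<bar> \<le> norm_SA M Q"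
  using norm_SA_le_iff[of Q "norm_SA M Q"] by simp

lemma norm_S_le_iff: "norm_S M d \<le> b \<longleftrightarrow> (\<forall>s\<in>S. \<bar>d s\<bar> \<le> b)"
  unfolding norm_S_def by (subst Max_le_iff) auto

lemma norm_S_ge: "s \<in> S \<Longrightarrow> \<bar>d s\<bar> \<le> norm_S M d"
  using norm_S_le_iff[of d "norm_S M d"] by simp

lemma norm_S_nonneg: "0 \<le> norm_S M d"
proof -
  obtain s where "s \<in> S" using S_ne by blast
  then show ?thesis using norm_S_ge[of s d] by simp
qed

lemma max_A_ge: "a \<in> A \<Longrightarrow> Q s a \<le> max_A M Q s"
  unfolding max_A_def by (intro Max_ge) auto

lemma max_A_leI: "(\<And>a. a \<in> A \<Longrightarrow> Q s a \<le> b) \<Longrightarrow> max_A M Q s \<le> b"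
  unfolding max_A_def by (subst Max_le_iff) auto

lemma max_A_diff_le:
  assumes "\<And>a. a \<in> A \<Longrightarrow> \<bar>Q s a - Q' s a\<bar> \<le> b"
  shows "\<bar>max_A M Q s - max_A M Q' s\<bar> \<le> b"
proof -
  have "max_A M Q s \<le> max_A M Q' s + b"
    by (rule max_A_leI) (use assms max_A_ge[of _ Q' s] in force)
  moreover have "max_A M Q' s \<le> max_A M Q s + b"
    by (rule max_A_leI) (use assms max_A_ge[of _ Q s] in force)
  ultimately show ?thesis by linarith
qed

lemma average_le:
  assumes "s \<in> S" "a \<in> A" "\<And>s'. s' \<in> S \<Longrightarrow> f s' \<le> g s' + b"
  shows "(\<Sum>s'\<in>S. pmf (P s a) s' * f s') \<le> (\<Sum>s'\<in>S. pmf (P s a) s' * g s') + b"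
proof -
  have "(\<Sum>s'\<in>S. pmf (P s a) s' * f s') \<le> (\<Sum>s'\<in>S. pmf (P s a) s' * (g s' + b))"
    by (intro sum_mono mult_left_mono assms) auto
  also have "\<dots> = (\<Sum>s'\<in>S. pmf (P s a) s' * g s') + b"
    using sum_trans[OF assms(1,2)] by (simp add: algebra_simps sum.distrib flip: sum_distrib_left)
  finally show ?thesis .
qed

text \<open>The one-sided form covers both uses: b = 0 is monotonicity, and applying it in both
  directions gives the contraction.\<close>

lemma bellman_le:
  assumes "s \<in> S" "a \<in> A" "\<And>s a. s \<in> S \<Longrightarrow> a \<in> A \<Longrightarrow> Q s a \<le> Q' s a + b"
  shows "bellman M Q s a \<le> bellman M Q' s a + \<gamma> * b"
proof -
  have "max_A M Q s \<le> max_A M Q' s + b" if "s \<in> S" for s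
    by (rule max_A_leI) (use assms(3)[OF that] max_A_ge[of _ Q' s] in force)
  from average_le[OF assms(1,2) this] show ?thesis
    using discount_pos unfolding bellman_def by (simp flip: distrib_left)
qed

lemma bellman_greedy:
  assumes "\<And>s. s \<in> S \<Longrightarrow> \<pi> s \<in> A" "\<And>s a. s \<in> S \<Longrightarrow> a \<in> A \<Longrightarrow> Q s a \<le> Q s (\<pi> s)"
  shows "bellman M Q s a = reward M s a + \<gamma> * (\<Sum>s'\<in>S. pmf (P s a) s' * Q s' (\<pi> s'))"
proof -
  have "max_A M Q s = Q s (\<pi> s)" if "s \<in> S" for s
    using that assms by (intro antisym max_A_leI max_A_ge)
  then show ?thesis unfolding bellman_def by (simp cong: sum.cong)
qed

text \<open>A policy maximising the total value over all state-action pairs cannot be improved by its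
  greedy policy, hence its value function is a fixed point of the Bellman operator.\<close>

lemma optimal_policy:
  obtains \<pi> where "\<pi> \<in> S \<rightarrow>\<^sub>E A"
    "\<And>s a. s \<in> S \<Longrightarrow> a \<in> A \<Longrightarrow> bellman M (policy_value M \<pi>) s a = policy_value M \<pi> s a"
    "\<And>s a. s \<in> S \<Longrightarrow> a \<in> A \<Longrightarrow> opt_value M s a = policy_value M \<pi> s a"
proof -
  \<comment> \<open>Pointwise comparison of policies is only partial; the sum gives a total order,
    so a maximiser exists among the finitely many policies.\<close>
  let ?\<Phi> = "\<lambda>\<pi>. \<Sum>(s, a)\<in>S \<times> A. policy_value M \<pi> s a"
  have fin: "finite (S \<rightarrow>\<^sub>E A)" by (intro finite_PiE) auto
  have ne: "S \<rightarrow>\<^sub>E A \<noteq> {}" by (simp add: PiE_eq_empty_iff)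
  have "Max (?\<Phi> ` (S \<rightarrow>\<^sub>E A)) \<in> ?\<Phi> ` (S \<rightarrow>\<^sub>E A)"
    using fin ne by (intro Max_in) auto
  then obtain p where p: "p \<in> S \<rightarrow>\<^sub>E A" and "Max (?\<Phi> ` (S \<rightarrow>\<^sub>E A)) = ?\<Phi> p" by auto
  then have p_max: "?\<Phi> q \<le> ?\<Phi> p" if "q \<in> S \<rightarrow>\<^sub>E A" for q
    using Max_ge[of "?\<Phi> ` (S \<rightarrow>\<^sub>E A)" "?\<Phi> q"] fin that by simp
  define Q where "Q = policy_value M p"
  have "\<exists>a. a \<in> A \<and> (\<forall>b\<in>A. Q s b \<le> Q s a)" for s
  proof -
    have "Max (Q s ` A) \<in> Q s ` A" by (intro Max_in) auto
    then obtain a where "a \<in> A" "Max (Q s ` A) = Q s a" by blast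
    then show ?thesis using Max_ge[of "Q s ` A"] by (intro exI[of _ a]) auto
  qed
  then obtain g where g: "\<And>s. g s \<in> A" "\<And>s b. b \<in> A \<Longrightarrow> Q s b \<le> Q s (g s)" by metis
  define q where "q = restrict g S"
  have q: "q \<in> S \<rightarrow>\<^sub>E A" using g by (auto simp: q_def)
  have Bq: "bellman M Q s a = reward M s a + \<gamma> * (\<Sum>s'\<in>S. pmf (P s a) s' * Q s' (q s'))" for s a
    by (rule bellman_greedy) (auto simp: q_def g)
  have eval: "policy_value M \<pi> s a = reward M s a + \<gamma> * (\<Sum>s'\<in>S. pmf (P s a) s' * policy_value M \<pi> s' (\<pi> s'))"
    if "\<pi> \<in> S \<rightarrow>\<^sub>E A" "s \<in> S" "a \<in> A" for \<pi> s a
    using that by (intro policy_value_Bellman) auto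
  have le: "policy_value M \<pi> s a \<le> bellman M (policy_value M \<pi>) s a"
    if "\<pi> \<in> S \<rightarrow>\<^sub>E A" "s \<in> S" "a \<in> A" for \<pi> s a
    unfolding eval[OF that] bellman_def using that discount_pos
    by (intro add_left_mono mult_left_mono sum_mono max_A_ge) auto
  have improve: "Q s a \<le> policy_value M q s a" if "s \<in> S" "a \<in> A" for s a
  proof -
    have "Q s a - policy_value M q s a \<le> 0 / (1 - \<gamma>)"
    proof (rule discounted_le[of "\<lambda>s a. Q s a - policy_value M q s a", OF _ that])
      fix B s a assume B: "\<And>s a. s \<in> S \<Longrightarrow> a \<in> A \<Longrightarrow> Q s a - policy_value M q s a \<le> B"
        and sa: "s \<in> S" "a \<in> A"
      have "(\<Sum>s'\<in>S. pmf (P s a) s' * Q s' (q s')) \<le> (\<Sum>s'\<in>S. pmf (P s a) s' * policy_value M q s' (q s')) + B"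
        by (intro average_le sa) (use B q in fastforce)
      then have "\<gamma> * (\<Sum>s'\<in>S. pmf (P s a) s' * Q s' (q s')) \<le> \<gamma> * (\<Sum>s'\<in>S. pmf (P s a) s' * policy_value M q s' (q s')) + \<gamma> * B"
        using discount_pos by (simp flip: distrib_left)
      then show "Q s a - policy_value M q s a \<le> 0 + \<gamma> * B"
        using le[OF p sa] unfolding eval[OF q sa] Bq Q_def[symmetric] by linarith
    qed
    then show ?thesis by simp
  qed
  have eq: "Q s a = policy_value M q s a" if sa: "s \<in> S" "a \<in> A" for s a
  proof (rule ccontr)
    assume "Q s a \<noteq> policy_value M q s a"
    then have "?\<Phi> p < ?\<Phi> q"
      using improve sa unfolding Q_def
      by (intro sum_strict_mono_ex1) (force intro!: bexI[of _ "(s, a)"])+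
    then show False using p_max[OF q] by simp
  qed
  have fp: "bellman M Q s a = Q s a" if "s \<in> S" "a \<in> A" for s a
    using eval[OF q that] Bq[of s a] eq q that by (auto simp: PiE_iff cong: sum.cong)
  \<comment> \<open>Every policy value lies below its own Bellman image and Q is a fixed point, so
    the excess over Q shrinks by \<gamma> and cannot be positive.\<close>
  have best: "policy_value M \<pi> s a \<le> Q s a" if \<pi>: "\<pi> \<in> S \<rightarrow>\<^sub>E A" and "s \<in> S" "a \<in> A" for \<pi> s a
  proof -
    have "policy_value M \<pi> s a - Q s a \<le> 0 / (1 - \<gamma>)"
    proof (rule discounted_le[of "\<lambda>s a. policy_value M \<pi> s a - Q s a", OF _ that(2,3)])
      fix B s a assume B: "\<And>s a. s \<in> S \<Longrightarrow> a \<in> A \<Longrightarrow> policy_value M \<pi> s a - Q s a \<le> B"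
        and sa: "s \<in> S" "a \<in> A"
      have "bellman M (policy_value M \<pi>) s a \<le> bellman M Q s a + \<gamma> * B"
        by (intro bellman_le sa) (use B in force)
      then show "policy_value M \<pi> s a - Q s a \<le> 0 + \<gamma> * B"
        using le[OF \<pi> sa] fp[OF sa] by linarith
    qed
    then show ?thesis by simp
  qed
  have "opt_value M s a = Q s a" if "s \<in> S" "a \<in> A" for s a
    unfolding opt_value_def using fin p best that by (intro Max_eqI) (auto simp: Q_def)
  with p fp show thesis by (intro that[of p]) (auto simp: Q_def)
qed

text \<open>The optimal value is known to equal a policy value on the carriers only;
  \<open>bellman_le\<close> with b = 0 transports the fixed point equation across that
  agreement.\<close>

lemma bellman_opt_value:
  assumes "s \<in> S" "a \<in> A"
  shows "bellman M (opt_value M) s a = opt_value M s a"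
proof -
  obtain \<pi> where \<pi>: "\<And>s a. s \<in> S \<Longrightarrow> a \<in> A \<Longrightarrow> bellman M (policy_value M \<pi>) s a = policy_value M \<pi> s a"
    "\<And>s a. s \<in> S \<Longrightarrow> a \<in> A \<Longrightarrow> opt_value M s a = policy_value M \<pi> s a"
    using optimal_policy by metis
  have "bellman M (opt_value M) s a \<le> bellman M (policy_value M \<pi>) s a + \<gamma> * 0"
    "bellman M (policy_value M \<pi>) s a \<le> bellman M (opt_value M) s a + \<gamma> * 0"
    using assms by (intro bellman_le; simp add: \<pi>)+
  then show ?thesis using \<pi> assms by simp
qed

text \<open>Compare with the zero table, whose Bellman image is the reward. The bound serves to
  express the number of loops through \<epsilon> and \<gamma> alone.\<close>

lemma norm_opt_value_le: "norm_SA M (opt_value M) \<le> 1 / (1 - \<gamma>)"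
proof -
  have "\<bar>opt_value M s a\<bar> \<le> 1 / (1 - \<gamma>)" if "s \<in> S" "a \<in> A" for s a
  proof (rule discounted_le[of "\<lambda>s a. \<bar>opt_value M s a\<bar>", OF _ that])
    fix B s a assume B: "\<And>s a. s \<in> S \<Longrightarrow> a \<in> A \<Longrightarrow> \<bar>opt_value M s a\<bar> \<le> B" and sa: "s \<in> S" "a \<in> A"
    have "bellman M (opt_value M) s a \<le> bellman M (\<lambda>_ _. 0) s a + \<gamma> * B"
      "bellman M (\<lambda>_ _. 0) s a \<le> bellman M (opt_value M) s a + \<gamma> * B"
      using B by (intro bellman_le sa; force simp: abs_le_iff)+
    moreover have "bellman M (\<lambda>_ _. 0) s a = reward M s a"
      by (simp add: bellman_def max_A_def)
    ultimately show "\<bar>opt_value M s a\<bar> \<le> 1 + \<gamma> * B"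
      using bellman_opt_value[OF sa] reward_range[OF sa] by linarith
  qed
  then show ?thesis by (simp add: norm_SA_le_iff)
qed

text \<open>The optimal value and the value of the greedy policy are fixed points of two
  \<gamma>-contractions which agree at Q, since the policy attains the maxima of Q. Each fixed point
  is thus within \<open>?\<rho> / (1 - \<gamma>)\<close> of Q, and the triangle inequality gives the
  factor 2.\<close>

lemma greedy_policy_error:
  assumes greedy: "argmax_rule M sel"
  shows "norm_SA M (\<lambda>s a. opt_value M s a - policy_value M (sel Q) s a)
    \<le> 2 / (1 - \<gamma>) * norm_SA M (\<lambda>s a. Q s a - bellman M Q s a)"
proof -
  let ?\<pi> = "sel Q" and ?\<rho> = "norm_SA M (\<lambda>s a. Q s a - bellman M Q s a)"
  have \<pi>: "?\<pi> \<in> S \<rightarrow> A" and \<pi>_max: "\<And>s a. s \<in> S \<Longrightarrow> a \<in> A \<Longrightarrow> Q s a \<le> Q s (?\<pi> s)"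
    using greedy by (auto simp: argmax_rule_def)
  have \<rho>: "\<bar>Q s a - bellman M Q s a\<bar> \<le> ?\<rho>" if "s \<in> S" "a \<in> A" for s a
    using norm_SA_ge[OF that, of "\<lambda>s a. Q s a - bellman M Q s a"] by simp
  have opt: "\<bar>opt_value M s a - Q s a\<bar> \<le> ?\<rho> / (1 - \<gamma>)" if "s \<in> S" "a \<in> A" for s a
  proof (rule discounted_le[of "\<lambda>s a. \<bar>opt_value M s a - Q s a\<bar>", OF _ that])
    fix B s a assume B: "\<And>s a. s \<in> S \<Longrightarrow> a \<in> A \<Longrightarrow> \<bar>opt_value M s a - Q s a\<bar> \<le> B" and sa: "s \<in> S" "a \<in> A"
    have "bellman M (opt_value M) s a \<le> bellman M Q s a + \<gamma> * B"
      "bellman M Q s a \<le> bellman M (opt_value M) s a + \<gamma> * B"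
      using B by (intro bellman_le sa; force simp: abs_le_iff)+
    then show "\<bar>opt_value M s a - Q s a\<bar> \<le> ?\<rho> + \<gamma> * B"
      using bellman_opt_value[OF sa] \<rho>[OF sa] by linarith
  qed
  have pol: "\<bar>Q s a - policy_value M ?\<pi> s a\<bar> \<le> ?\<rho> / (1 - \<gamma>)" if "s \<in> S" "a \<in> A" for s a
  proof (rule discounted_le[of "\<lambda>s a. \<bar>Q s a - policy_value M ?\<pi> s a\<bar>", OF _ that])
    fix B s a assume B: "\<And>s a. s \<in> S \<Longrightarrow> a \<in> A \<Longrightarrow> \<bar>Q s a - policy_value M ?\<pi> s a\<bar> \<le> B" and sa: "s \<in> S" "a \<in> A"
    let ?E = "\<lambda>W. \<Sum>s'\<in>S. pmf (P s a) s' * W s' (?\<pi> s')"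
    have B': "\<bar>Q s' (?\<pi> s') - policy_value M ?\<pi> s' (?\<pi> s')\<bar> \<le> B" if "s' \<in> S" for s'
      using B that \<pi> by auto
    have "?E Q \<le> ?E (policy_value M ?\<pi>) + B" "?E (policy_value M ?\<pi>) \<le> ?E Q + B"
      by (intro average_le sa, use B' in force)+
    then have "\<gamma> * ?E Q \<le> \<gamma> * ?E (policy_value M ?\<pi>) + \<gamma> * B" "\<gamma> * ?E (policy_value M ?\<pi>) \<le> \<gamma> * ?E Q + \<gamma> * B"
      using discount_pos by (simp_all flip: distrib_left)
    moreover have "bellman M Q s a = reward M s a + \<gamma> * ?E Q"
      using \<pi> \<pi>_max by (intro bellman_greedy) auto
    ultimately show "\<bar>Q s a - policy_value M ?\<pi> s a\<bar> \<le> ?\<rho> + \<gamma> * B"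
      using policy_value_Bellman[OF \<pi> sa] \<rho>[OF sa] by linarith
  qed
  have "\<bar>opt_value M s a - policy_value M ?\<pi> s a\<bar> \<le> 2 / (1 - \<gamma>) * ?\<rho>" if "s \<in> S" "a \<in> A" for s a
    using opt[OF that] pol[OF that] by simp
  then show ?thesis by (simp add: norm_SA_le_iff)
qed

end

section \<open>Concentration of the estimates\<close>

text \<open>Hoeffding's lemma on an interval of length 2b, with (2b)^2/8 = b^2/2. It is stated for l
  > 0; negative l is reduced to it by negating f.\<close>

lemma mgf_centered_pmf:
  fixes f :: "'s \<Rightarrow> real"
  assumes bound: "\<And>x. x \<in> set_pmf p \<Longrightarrow> \<bar>f x\<bar> \<le> b"
  shows "(\<integral>\<^sup>+x. ennreal (exp (l * (f x - measure_pmf.expectation p f))) \<partial>p) \<le> ennreal (exp (l\<^sup>2 * b\<^sup>2 / 2))"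
proof -
  have pos: "(\<integral>\<^sup>+x. ennreal (exp (l * (f x - measure_pmf.expectation p f))) \<partial>p) \<le> ennreal (exp (l\<^sup>2 * b\<^sup>2 / 2))"
    if "0 < l" "\<And>x. x \<in> set_pmf p \<Longrightarrow> \<bar>f x\<bar> \<le> b" for l and f :: "'s \<Rightarrow> real"
  proof -
    interpret interval_bounded_random_variable "measure_pmf p" f "-b" b
      by unfold_locales (use that in \<open>force simp: AE_measure_pmf_iff abs_le_iff\<close>)+
    show ?thesis
      using Hoeffdings_lemma_nn_integral[OF \<open>0 < l\<close>] by (simp add: power2_eq_square mult_ac)
  qed
  consider "0 < l" | "l = 0" | "0 < - l" by linarith
  then show ?thesis
  proof cases
    case 1
    then show ?thesis using pos bound by blast
  next
    case 3
    then show ?thesis using pos[of "-l" "\<lambda>x. - f x"] bound by (simp add: algebra_simps)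
  qed (simp add: measure_pmf.emeasure_space_1[simplified])
qed

lemma c_seq_pos: "0 < c_seq k"
  by (simp add: c_seq_def)

text \<open>Telescoping replaces the integral test, with antiderivative -1/ln. The factor 5 in
  \<open>c_seq\<close> is what brings the total below 1: with ln 2 > 1/2 the term at 0 is at most
  4/10 and the tail at most 2/5.\<close>

lemma sum_inverse_c_seq_le: "(\<Sum>j<k. 1 / c_seq j) \<le> 1"
proof -
  have step: "1 / ((real j + 3) * (ln (real j + 3))\<^sup>2) \<le> 1 / ln (real j + 2) - 1 / ln (real j + 3)" for j :: nat
  proof -
    let ?a = "ln (real j + 2)" and ?b = "ln (real j + 3)"
    have ab: "0 < ?a" "?a \<le> ?b" by auto
    have "ln ((real j + 2) / (real j + 3)) \<le> (real j + 2) / (real j + 3) - 1"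
      by (intro ln_le_minus_one) auto
    then have "1 / (real j + 3) \<le> ?b - ?a"
      by (simp add: ln_div field_simps)
    then have "1 / (real j + 3) * (1 / (?b * ?b)) \<le> (?b - ?a) * (1 / (?a * ?b))"
      using ab by (intro mult_mono divide_left_mono mult_right_mono mult_pos_pos) auto
    then show ?thesis using ab by (simp add: field_simps power2_eq_square)
  qed
  have ln2: "1 / 2 < ln (2::real)" using ln2_ge_two_thirds by simp
  have tail: "(\<Sum>j<k. 1 / c_seq (Suc j)) \<le> (1 / ln 2 - 1 / ln (real k + 2)) / 5" for k
  proof (induction k)
    case (Suc k)
    have "1 / c_seq (Suc k) = 1 / ((real k + 3) * (ln (real k + 3))\<^sup>2) / 5"
      by (simp add: c_seq_def add_ac)
    moreover have "real (Suc k) + 2 = real k + 3" by simp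
    moreover have "x + t / 5 \<le> (p - r) / 5" if "x \<le> (p - q) / 5" "t \<le> q - r" for x t p q r :: real
      using that by simp
    ultimately show ?case
      using Suc step[of k] by (simp only: sum.lessThan_Suc)
  qed simp
  have "(\<Sum>j<k. 1 / c_seq j) \<le> (\<Sum>j<Suc k. 1 / c_seq j)"
    using c_seq_pos[of k] by simp
  also have "\<dots> = 1 / c_seq 0 + (\<Sum>j<k. 1 / c_seq (Suc j))"
    by (rule sum.lessThan_Suc_shift)
  also have "\<dots> \<le> 1 / c_seq 0 + 1 / ln 2 / 5"
  proof -
    have "0 < 1 / ln (real k + 2) / 5" by simp
    then show ?thesis using tail[of k] unfolding diff_divide_distrib by linarith
  qed
  also have "1 / c_seq 0 \<le> 4 / 10"
  proof -
    have "1 / (ln (2::real))\<^sup>2 \<le> 1 / (1 / 2)\<^sup>2"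
      using ln2 by (intro divide_left_mono power_mono) auto
    then show ?thesis by (simp add: c_seq_def power2_eq_square)
  qed
  also have "1 / ln 2 / 5 \<le> (2::real) / 5"
    using ln2 by (simp add: field_simps)
  finally show ?thesis by simp
qed

context unit_reward_mdp
begin

text \<open>An average of values of d on \<open>S\<close> cannot exceed its norm. The bound holds
  for every outcome, so the growth of the increments needs no concentration argument.\<close>

lemma set_SAMPLE:
  assumes "D \<in> set_pmf (SAMPLE M d m)" "1 \<le> m" "s \<in> S" "a \<in> A"
  shows "\<bar>D s a\<bar> \<le> norm_S M d"
proof -
  obtain X where X: "X \<in> set_pmf (Pi_pmf (S \<times> A \<times> {..<m}) undefined (\<lambda>(s, a, j). P s a))"
    and D: "D s a = (\<Sum>j<m. d (X (s, a, j))) / real m"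
    using assms(1) by (auto simp: SAMPLE_def)
  have "\<bar>d (X (s, a, j))\<bar> \<le> norm_S M d" if "j < m" for j
    using X that assms set_trans[of s a] by (intro norm_S_ge) (force simp: set_Pi_pmf PiE_dflt_def)
  then have "(\<Sum>j<m. \<bar>d (X (s, a, j))\<bar>) \<le> real m * norm_S M d"
    using sum_bounded_above[of "{..<m}" "\<lambda>j. \<bar>d (X (s, a, j))\<bar>"] by simp
  then have "\<bar>\<Sum>j<m. d (X (s, a, j))\<bar> \<le> real m * norm_S M d"
    using sum_abs[of "\<lambda>j. d (X (s, a, j))" "{..<m}"] by linarith
  then show ?thesis
    using assms(2) unfolding D by (simp add: field_simps)
qed

text \<open>By independence the exponential moment is a product of m factors, each with parameter
  l/m; the exponents add up to m (l/m)^2 |d|^2 / 2.\<close>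

lemma mgf_SAMPLE:
  assumes "1 \<le> m" and sa: "s \<in> S" "a \<in> A"
  shows "(\<integral>\<^sup>+D. ennreal (exp (l * (D s a - (\<Sum>s'\<in>S. pmf (P s a) s' * d s')))) \<partial>SAMPLE M d m)
    \<le> ennreal (exp (l\<^sup>2 * (norm_S M d)\<^sup>2 / (2 * real m)))"
proof -
  let ?\<mu> = "\<Sum>s'\<in>S. pmf (P s a) s' * d s'" and ?I = "S \<times> A \<times> {..<m}"
  have E: "measure_pmf.expectation (P s a) d = ?\<mu>"
    using set_trans[OF sa] by (subst integral_measure_pmf[of S]) auto
  \<comment> \<open>The product measure runs over all state-action pairs; f is constantly 1 off the
    pair in question, so the other factors integrate to 1.\<close>
  define f where "f = (\<lambda>(s', a', j::nat) x. if s' = s \<and> a' = a then ennreal (exp (l / m * (d x - ?\<mu>))) else 1)"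
  have split: "(\<Prod>i\<in>?I. g i) = (\<Prod>j<m. g (s, a, j))"
    if "\<And>i. i \<in> ?I \<Longrightarrow> i \<notin> (\<lambda>j. (s, a, j)) ` {..<m} \<Longrightarrow> g i = 1" for g :: "_ \<Rightarrow> ennreal"
  proof -
    have "(\<Prod>i\<in>?I. g i) = (\<Prod>i\<in>(\<lambda>j. (s, a, j)) ` {..<m}. g i)"
      using that sa by (intro prod.mono_neutral_right) auto
    also have "\<dots> = (\<Prod>j<m. g (s, a, j))"
      by (subst prod.reindex) (auto simp: inj_on_def)
    finally show ?thesis .
  qed
  have "(\<integral>\<^sup>+D. ennreal (exp (l * (D s a - ?\<mu>))) \<partial>SAMPLE M d m)
      = (\<integral>\<^sup>+X. (\<Prod>i\<in>?I. f i (X i)) \<partial>Pi_pmf ?I undefined (\<lambda>(s, a, j). P s a))"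
    unfolding SAMPLE_def nn_integral_map_pmf
  proof (rule nn_integral_cong)
    fix X :: "'s \<times> 'a \<times> nat \<Rightarrow> 's"
    have "l * ((\<Sum>j<m. d (X (s, a, j))) / real m - ?\<mu>) = (\<Sum>j<m. l / m * (d (X (s, a, j)) - ?\<mu>))"
      using \<open>1 \<le> m\<close> by (simp add: sum_subtractf field_simps flip: sum_distrib_left sum_divide_distrib)
    then have "ennreal (exp (l * ((\<Sum>j<m. d (X (s, a, j))) / real m - ?\<mu>)))
        = (\<Prod>j<m. ennreal (exp (l / m * (d (X (s, a, j)) - ?\<mu>))))"
      by (simp only: exp_sum finite_lessThan prod_ennreal exp_ge_zero)
    also have "\<dots> = (\<Prod>i\<in>?I. f i (X i))"
      by (subst split) (auto simp: f_def)
    finally show "ennreal (exp (l * ((\<Sum>j<m. d (X (s, a, j))) / real m - ?\<mu>))) = (\<Prod>i\<in>?I. f i (X i))" .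
  qed
  also have "\<dots> = (\<Prod>i\<in>?I. nn_integral (case i of (s, a, j) \<Rightarrow> P s a) (f i))"
    by (rule nn_integral_prod_Pi_pmf) auto
  also have "\<dots> = (\<Prod>j<m. \<integral>\<^sup>+x. ennreal (exp (l / m * (d x - ?\<mu>))) \<partial>P s a)"
  proof (subst split)
    fix i assume i: "i \<in> ?I" "i \<notin> (\<lambda>j. (s, a, j)) ` {..<m}"
    then have "f i = (\<lambda>_. 1)" by (cases i) (auto simp: f_def fun_eq_iff image_iff)
    then show "nn_integral (case i of (s, a, j) \<Rightarrow> P s a) (f i) = 1"
      by (cases i) (simp add: measure_pmf.emeasure_space_1[simplified])
  qed (simp add: f_def)
  also have "\<dots> \<le> (\<Prod>j<m. ennreal (exp ((l / m)\<^sup>2 * (norm_S M d)\<^sup>2 / 2)))"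
    using mgf_centered_pmf[of "P s a" d "norm_S M d" "l / m"] set_trans[OF sa] norm_S_ge[of _ d]
    unfolding E by (intro prod_mono_ennreal) auto
  also have "\<dots> = ennreal (exp (\<Sum>j<m. (l / m)\<^sup>2 * (norm_S M d)\<^sup>2 / 2))"
    by (simp only: exp_sum finite_lessThan prod_ennreal exp_ge_zero)
  also have "(\<Sum>j<m. (l / m)\<^sup>2 * (norm_S M d)\<^sup>2 / 2) = l\<^sup>2 * (norm_S M d)\<^sup>2 / (2 * real m)"
    using \<open>1 \<le> m\<close> by (simp add: power2_eq_square field_simps)
  finally show ?thesis .
qed

text \<open>This is \<gamma> times the accumulated sampling errors
  \<open>D\<^sup>j - P d\<^sup>j\<close>, because the increments \<open>d\<^sup>j\<close> telescope
  to the current V.\<close>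

definition bias :: "('s, 'a) savid_state \<Rightarrow> 's \<Rightarrow> 'a \<Rightarrow> real" where
  "bias st s a = cur_T st s a - bellman M (cur_Q st) s a"

end

section \<open>The bias as a martingale along one run\<close>

locale savid_run = unit_reward_mdp M for M :: "('s, 'a) mdp" +
  fixes \<epsilon> \<alpha> :: real
  assumes eps_pos: "0 < \<epsilon>" and alpha_pos: "0 < \<alpha>"
begin

abbreviation "iter \<equiv> savid_iter M c_seq \<beta>_seq (\<lambda>_ _. 0) \<epsilon> \<alpha>"
abbreviation "step \<equiv> savid_step M c_seq \<beta>_seq (\<lambda>_ _. 0) \<epsilon> \<alpha>"

text \<open>The anchor term is absent because the anchor is the zero table.\<close>

definition next_Q :: "nat \<Rightarrow> ('s, 'a) savid_state \<Rightarrow> 's \<Rightarrow> 'a \<Rightarrow> real" where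
  "next_Q k st = (\<lambda>s a. \<beta>_seq k * cur_T st s a)"

definition increment :: "nat \<Rightarrow> ('s, 'a) savid_state \<Rightarrow> 's \<Rightarrow> real" where
  "increment k st = (\<lambda>s. max_A M (next_Q k st) s - cur_V st s)"

definition batch :: "nat \<Rightarrow> ('s, 'a) savid_state \<Rightarrow> nat" where
  "batch k st = max (nat \<lceil>2 * \<alpha> * c_seq k * (norm_S M (increment k st))\<^sup>2 / \<epsilon>\<^sup>2\<rceil>) 1"

definition update :: "nat \<Rightarrow> ('s, 'a) savid_state \<Rightarrow> ('s \<Rightarrow> 'a \<Rightarrow> real) \<Rightarrow> ('s, 'a) savid_state" where
  "update k st D =
     \<lparr>cur_Q = next_Q k st, cur_T = (\<lambda>s a. cur_T st s a + \<gamma> * D s a), cur_V = max_A M (next_Q k st),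
      n_samples = n_samples st + n_SA M * batch k st,
      n_steps = n_steps st + 3 * n_SA M + 2 * card S + 1 + (2 * n_SA M * batch k st + n_SA M)\<rparr>"

lemma step_eq: "step k st = map_pmf (update k st) (SAMPLE M (increment k st) (batch k st))"
  unfolding savid_step_def update_def[abs_def] batch_def increment_def next_Q_def Let_def by simp

lemma batch_ge_1: "1 \<le> batch k st"
  by (simp add: batch_def)

lemma batch_ge: "2 * \<alpha> * c_seq k * (norm_S M (increment k st))\<^sup>2 / \<epsilon>\<^sup>2 \<le> real (batch k st)"
  unfolding batch_def by linarith

lemma batch_le: "real (batch k st) \<le> 2 * \<alpha> * c_seq k * (norm_S M (increment k st))\<^sup>2 / \<epsilon>\<^sup>2 + 1"
proof -
  have "0 \<le> 2 * \<alpha> * c_seq k * (norm_S M (increment k st))\<^sup>2 / \<epsilon>\<^sup>2"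
    using alpha_pos c_seq_pos[of k] by simp
  then show ?thesis unfolding batch_def by linarith
qed

lemma cur_V_iter: "st \<in> set_pmf (iter k) \<Longrightarrow> cur_V st = max_A M (cur_Q st)"
  by (cases k) (auto simp: savid_init_def max_A_def fun_eq_iff step_eq update_def)

text \<open>As \<open>cur_V\<close> is the maximum of \<open>cur_Q\<close>, the Bellman image moves
  by exactly \<gamma> times the mean of the increment, while T moves by \<gamma> times its sampled
  average. The difference is centered given the state.\<close>

lemma bias_update:
  assumes "cur_V st = max_A M (cur_Q st)"
  shows "bias (update k st D) s a =
    bias st s a + \<gamma> * (D s a - (\<Sum>s'\<in>S. pmf (P s a) s' * increment k st s'))"
  unfolding bias_def bellman_def update_def increment_def assms
  by (simp add: algebra_simps sum_subtractf)

text \<open>Increment and batch size are functions of the state, so \<open>mgf_SAMPLE\<close>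
  applies conditionally. The lower bound on the batch size cancels the random norm and leaves the
  deterministic factor \<open>?v\<close>, which leaves the expectation over earlier states.\<close>

lemma mgf_bias:
  assumes sa: "s \<in> S" "a \<in> A"
  shows "(\<integral>\<^sup>+st. ennreal (exp (l * bias st s a)) \<partial>iter k)
    \<le> ennreal (exp (l\<^sup>2 * \<epsilon>\<^sup>2 / (4 * \<alpha>) * (\<Sum>j<k. 1 / c_seq j)))"
proof (induction k)
  case 0
  have "bellman M (\<lambda>_ _. 0) s a = reward M s a"
    by (simp add: bellman_def max_A_def)
  then show ?case by (simp add: bias_def savid_init_def)
next
  case (Suc k)
  let ?v = "l\<^sup>2 * \<epsilon>\<^sup>2 / (4 * \<alpha>) / c_seq k"
  have one: "(\<integral>\<^sup>+st'. ennreal (exp (l * bias st' s a)) \<partial>step k st) \<le> ennreal (exp (l * bias st s a)) * ennreal (exp ?v)"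
    if "st \<in> set_pmf (iter k)" for st
  proof -
    let ?d = "increment k st" and ?m = "batch k st"
    have "(\<integral>\<^sup>+st'. ennreal (exp (l * bias st' s a)) \<partial>step k st)
        = (\<integral>\<^sup>+D. ennreal (exp (l * bias st s a)) *
              ennreal (exp (l * \<gamma> * (D s a - (\<Sum>s'\<in>S. pmf (P s a) s' * ?d s')))) \<partial>SAMPLE M ?d ?m)"
      unfolding step_eq nn_integral_map_pmf bias_update[OF cur_V_iter[OF that]]
      by (simp add: distrib_left exp_add ennreal_mult mult.assoc)
    also have "\<dots> = ennreal (exp (l * bias st s a)) *
        (\<integral>\<^sup>+D. ennreal (exp (l * \<gamma> * (D s a - (\<Sum>s'\<in>S. pmf (P s a) s' * ?d s')))) \<partial>SAMPLE M ?d ?m)"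
      by (rule nn_integral_cmult) simp
    also have "\<dots> \<le> ennreal (exp (l * bias st s a)) * ennreal (exp ((l * \<gamma>)\<^sup>2 * (norm_S M ?d)\<^sup>2 / (2 * real ?m)))"
      by (intro mult_left_mono mgf_SAMPLE batch_ge_1 sa) simp
    also have "(l * \<gamma>)\<^sup>2 * (norm_S M ?d)\<^sup>2 / (2 * real ?m) \<le> ?v"
    proof -
      have m: "0 < real ?m" using batch_ge_1[of k st] by linarith
      have "\<gamma>\<^sup>2 \<le> 1" using discount_pos discount_less_1 by (simp add: power_le_one)
      then have "\<gamma>\<^sup>2 * (norm_S M ?d)\<^sup>2 \<le> (norm_S M ?d)\<^sup>2"
        by (simp add: mult_left_le_one_le)
      also have "\<dots> \<le> \<epsilon>\<^sup>2 * real ?m / (2 * \<alpha> * c_seq k)"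
        using batch_ge[of k st] eps_pos alpha_pos c_seq_pos[of k] by (simp add: field_simps)
      finally have "l\<^sup>2 * (\<gamma>\<^sup>2 * (norm_S M ?d)\<^sup>2) / (2 * real ?m) \<le> l\<^sup>2 * (\<epsilon>\<^sup>2 * real ?m / (2 * \<alpha> * c_seq k)) / (2 * real ?m)"
        by (intro divide_right_mono mult_left_mono) auto
      also have "\<dots> = ?v" using m alpha_pos c_seq_pos[of k] by (simp add: field_simps)
      finally show ?thesis by (simp add: power_mult_distrib mult_ac)
    qed
    finally show ?thesis by (simp add: mult_left_mono ennreal_leI)
  qed
  have "(\<integral>\<^sup>+st. ennreal (exp (l * bias st s a)) \<partial>iter (Suc k))
      = (\<integral>\<^sup>+st. \<integral>\<^sup>+st'. ennreal (exp (l * bias st' s a)) \<partial>step k st \<partial>iter k)"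
    by simp
  also have "\<dots> \<le> (\<integral>\<^sup>+st. ennreal (exp (l * bias st s a)) * ennreal (exp ?v) \<partial>iter k)"
    by (intro nn_integral_mono_AE AE_pmfI one)
  also have "\<dots> = (\<integral>\<^sup>+st. ennreal (exp (l * bias st s a)) \<partial>iter k) * ennreal (exp ?v)"
    by (rule nn_integral_multc) simp
  also have "\<dots> \<le> ennreal (exp (l\<^sup>2 * \<epsilon>\<^sup>2 / (4 * \<alpha>) * (\<Sum>j<k. 1 / c_seq j))) * ennreal (exp ?v)"
    by (intro mult_right_mono Suc.IH) simp
  also have "\<dots> = ennreal (exp (l\<^sup>2 * \<epsilon>\<^sup>2 / (4 * \<alpha>) * (\<Sum>j<Suc k. 1 / c_seq j)))"
    by (simp add: distrib_left flip: ennreal_mult exp_add)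
  finally show ?case .
qed

lemma tail_bias:
  assumes sa: "s \<in> S" "a \<in> A"
  shows "measure_pmf.prob (iter k) {st. \<bar>bias st s a\<bar> > \<epsilon>} \<le> 2 * exp (- \<alpha>)"
proof -
  have "measure_pmf.prob (iter k) {st. \<epsilon> \<le> \<sigma> * bias st s a} \<le> exp (- \<alpha>)" if \<sigma>: "\<sigma> = 1 \<or> \<sigma> = -1" for \<sigma>
  proof -
    \<comment> \<open>The minimiser of -l\<epsilon> + l^2 \<epsilon>^2 / (4\<alpha>), where the
      value is -\<alpha>.\<close>
    let ?l = "2 * \<alpha> / \<epsilon>"
    have l: "0 < ?l" using alpha_pos eps_pos by simp
    have "emeasure (iter k) {st \<in> UNIV. \<epsilon> \<le> \<sigma> * bias st s a}
        \<le> ennreal (exp (- ?l * \<epsilon>)) * (\<integral>\<^sup>+st. ennreal (exp (?l * (\<sigma> * bias st s a))) * indicator UNIV st \<partial>iter k)"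
      by (rule Chernoff_ineq_nn_integral_ge[OF l]) auto
    also have "\<dots> = ennreal (exp (- ?l * \<epsilon>)) * (\<integral>\<^sup>+st. ennreal (exp ((?l * \<sigma>) * bias st s a)) \<partial>iter k)"
      by (simp add: mult.assoc)
    also have "\<dots> \<le> ennreal (exp (- ?l * \<epsilon>)) * ennreal (exp ((?l * \<sigma>)\<^sup>2 * \<epsilon>\<^sup>2 / (4 * \<alpha>) * (\<Sum>j<k. 1 / c_seq j)))"
      by (intro mult_left_mono mgf_bias sa) simp
    also have "\<dots> \<le> ennreal (exp (- ?l * \<epsilon>)) * ennreal (exp \<alpha>)"
    proof -
      have "(?l * \<sigma>)\<^sup>2 * \<epsilon>\<^sup>2 / (4 * \<alpha>) = \<alpha>"
        using eps_pos alpha_pos \<sigma> by (auto simp: power2_eq_square field_simps)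
      then have "(?l * \<sigma>)\<^sup>2 * \<epsilon>\<^sup>2 / (4 * \<alpha>) * (\<Sum>j<k. 1 / c_seq j) \<le> \<alpha>"
        using sum_inverse_c_seq_le[of k] alpha_pos by (simp add: mult_left_le)
      then show ?thesis by (intro mult_left_mono ennreal_leI) auto
    qed
    also have "\<dots> = ennreal (exp (- \<alpha>))"
      using eps_pos by (simp flip: ennreal_mult exp_add)
    finally show ?thesis by (simp add: measure_pmf.emeasure_eq_measure)
  qed
  from this[of 1] this[of "-1"]
  have "measure_pmf.prob (iter k) {st. \<epsilon> \<le> bias st s a} + measure_pmf.prob (iter k) {st. \<epsilon> \<le> - bias st s a} \<le> 2 * exp (- \<alpha>)"
    by simp
  moreover have "measure_pmf.prob (iter k) {st. \<bar>bias st s a\<bar> > \<epsilon>}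
      \<le> measure_pmf.prob (iter k) ({st. \<epsilon> \<le> bias st s a} \<union> {st. \<epsilon> \<le> - bias st s a})"
    by (intro measure_pmf.finite_measure_mono) auto
  moreover have "\<dots> \<le> measure_pmf.prob (iter k) {st. \<epsilon> \<le> bias st s a} + measure_pmf.prob (iter k) {st. \<epsilon> \<le> - bias st s a}"
    by (intro measure_Un_le) auto
  ultimately show ?thesis by linarith
qed

definition good :: "('s, 'a) savid_state \<Rightarrow> bool" where
  "good st \<longleftrightarrow> (\<forall>s\<in>S. \<forall>a\<in>A. \<bar>bias st s a\<bar> \<le> \<epsilon>)"

lemma prob_not_good: "measure_pmf.prob (iter k) {st. \<not> good st} \<le> real (n_SA M) * (2 * exp (- \<alpha>))"
proof -
  have "{st. \<not> good st} = (\<Union>x\<in>S \<times> A. {st. \<bar>bias st (fst x) (snd x)\<bar> > \<epsilon>})"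
    by (force simp: good_def not_le)
  then have "measure_pmf.prob (iter k) {st. \<not> good st}
      \<le> (\<Sum>x\<in>S \<times> A. measure_pmf.prob (iter k) {st. \<bar>bias st (fst x) (snd x)\<bar> > \<epsilon>})"
    by (simp add: measure_pmf.finite_measure_subadditive_finite)
  also have "\<dots> \<le> (\<Sum>x\<in>S \<times> A. 2 * exp (- \<alpha>))"
    by (intro sum_mono tail_bias) auto
  also have "\<dots> = real (n_SA M) * (2 * exp (- \<alpha>))"
    by (simp add: n_SA_def)
  finally show ?thesis .
qed

end

section \<open>One run of SAVID\<close>

context savid_run
begin

abbreviation "R \<equiv> norm_SA M (opt_value M)"

text \<open>After \<open>k\<close> iterations the state holds \<open>Q\<^sup>k\<^sup>-\<^sup>1\<close> and \<open>T\<^sup>k\<^sup>-\<^sup>1\<close> (with \<open>Q\<^sup>-\<^sup>1 = 0\<close>), and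
  \<open>next_Q k\<close> recovers \<open>Q\<^sup>k\<close> from it. Hence the increment \<open>Q\<^sup>k - Q\<^sup>k\<^sup>-\<^sup>1\<close> can be bounded by an
  invariant of the current state, without recording the history.\<close>

definition invariant :: "nat \<Rightarrow> ('s, 'a) savid_state \<Rightarrow> bool" where
  "invariant k st \<longleftrightarrow>
     (\<forall>s\<in>S. \<forall>a\<in>A. \<bar>cur_Q st s a - opt_value M s a\<bar> \<le> R + real k * \<epsilon> / 3) \<and>
     good st \<and>
     cur_V st = max_A M (cur_Q st) \<and>
     (\<forall>s\<in>S. \<forall>a\<in>A. (real k + 1) * (real k + 2) * \<bar>next_Q k st s a - cur_Q st s a\<bar>
        \<le> 4 * R * real k + \<epsilon> * ((real k)\<^sup>2 + 5 * real k) / 3) \<and>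
     real (n_samples st) \<le> real (n_SA M) *
        (\<Sum>j<k. 2 * \<alpha> * c_seq j * (4 * R / (real j + 2) + \<epsilon>)\<^sup>2 / \<epsilon>\<^sup>2 + 1) \<and>
     n_steps st \<le> 9 * n_samples st + 3 * n_SA M \<and>
     k * n_SA M \<le> n_samples st"

lemma R_nonneg: "0 \<le> R"
proof -
  obtain s a where "s \<in> S" "a \<in> A" using S_ne A_ne by blast
  then show ?thesis using norm_SA_ge[of s a "opt_value M"] by simp
qed

lemma invariant_init: "invariant 0 (savid_init M (\<lambda>_ _. 0))"
proof -
  have "bellman M (\<lambda>_ _. 0) s a = reward M s a" for s a
    by (simp add: bellman_def max_A_def)
  then show ?thesis
    using norm_SA_ge[of _ _ "opt_value M"] eps_pos card_S_le n_SA_pos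
    by (auto simp: invariant_def savid_init_def good_def bias_def next_Q_def \<beta>_seq_def max_A_def fun_eq_iff)
qed

text \<open>T is the Bellman image of Q plus the bias: the first is no farther from the fixed point
  than Q, the second adds \<epsilon>, written as 3\<epsilon>/3.\<close>

lemma invariant_cur_T:
  assumes inv: "invariant k st" and sa: "s \<in> S" "a \<in> A"
  shows "\<bar>cur_T st s a - opt_value M s a\<bar> \<le> R + (real k + 3) * \<epsilon> / 3"
    and "\<bar>cur_T st s a\<bar> \<le> 2 * R + (real k + 3) * \<epsilon> / 3"
proof -
  let ?b = "R + real k * \<epsilon> / 3"
  have "\<bar>cur_Q st s a - opt_value M s a\<bar> \<le> ?b" if "s \<in> S" "a \<in> A" for s a
    using inv that by (auto simp: invariant_def)
  then have "bellman M (cur_Q st) s a \<le> bellman M (opt_value M) s a + \<gamma> * ?b"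
    "bellman M (opt_value M) s a \<le> bellman M (cur_Q st) s a + \<gamma> * ?b"
    by (intro bellman_le sa; force simp: abs_le_iff)+
  moreover have "\<gamma> * ?b \<le> ?b"
    using R_nonneg eps_pos discount_pos discount_less_1 by (intro mult_left_le_one_le) auto
  moreover have "\<bar>bias st s a\<bar> \<le> \<epsilon>"
    using inv sa by (auto simp: invariant_def good_def)
  ultimately show "\<bar>cur_T st s a - opt_value M s a\<bar> \<le> R + (real k + 3) * \<epsilon> / 3"
    using bellman_opt_value[OF sa] unfolding bias_def by (simp add: algebra_simps add_divide_distrib)
  then show "\<bar>cur_T st s a\<bar> \<le> 2 * R + (real k + 3) * \<epsilon> / 3"
    using norm_SA_ge[OF sa, of "opt_value M"] by linarith
qed

text \<open>Maximisation over actions is nonexpansive, so the bound on Q passes to V. The first form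
  keeps the exact weights for the recursion; the second is rounded up for the batch sizes.\<close>

lemma invariant_increment:
  assumes inv: "invariant k st"
  shows "(real k + 1) * (real k + 2) * norm_S M (increment k st)
      \<le> 4 * R * real k + \<epsilon> * ((real k)\<^sup>2 + 5 * real k) / 3" (is "_ \<le> ?z")
    and "norm_S M (increment k st) \<le> 4 * R / (real k + 2) + \<epsilon>"
proof -
  have p: "0 < (real k + 1) * (real k + 2)" by (simp add: add_pos_pos)
  have diff: "\<bar>next_Q k st s a - cur_Q st s a\<bar> \<le> ?z / ((real k + 1) * (real k + 2))"
    if "s \<in> S" "a \<in> A" for s a
    using inv that p by (auto simp: invariant_def pos_le_divide_eq mult.commute)
  have "norm_S M (increment k st) \<le> ?z / ((real k + 1) * (real k + 2))"
    unfolding norm_S_le_iff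
  proof
    fix s assume "s \<in> S"
    then show "\<bar>increment k st s\<bar> \<le> ?z / ((real k + 1) * (real k + 2))"
      using inv unfolding increment_def invariant_def
      by (auto intro!: max_A_diff_le diff)
  qed
  then show z: "(real k + 1) * (real k + 2) * norm_S M (increment k st) \<le> ?z"
    using p by (simp add: pos_le_divide_eq mult.commute)
  have "?z \<le> 4 * R * (real k + 1) + \<epsilon> * (3 * ((real k + 1) * (real k + 2))) / 3"
    using R_nonneg eps_pos
    by (intro add_mono mult_left_mono divide_right_mono) (auto simp: power2_eq_square algebra_simps)
  also have "\<dots> = (real k + 1) * (real k + 2) * (4 * R / (real k + 2) + \<epsilon>)"
    by (simp add: field_simps)
  finally show "norm_S M (increment k st) \<le> 4 * R / (real k + 2) + \<epsilon>"
    using z p by (meson mult_le_cancel_left_pos order_trans)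
qed

text \<open>Given the old invariant, goodness of the new state is the only probabilistic input;
  everything else holds for every outcome of the sampling.\<close>

lemma invariant_update:
  assumes inv: "invariant k st" and D: "D \<in> set_pmf (SAMPLE M (increment k st) (batch k st))"
    and good: "good (update k st D)"
  shows "invariant (Suc k) (update k st D)"
  unfolding invariant_def
proof (intro conjI ballI)
  let ?st = "update k st D"
  fix s a assume sa: "s \<in> S" "a \<in> A"
  let ?T = "cur_T st s a" and ?o = "opt_value M s a"
  note T = invariant_cur_T[OF inv sa]
  have "real k * \<bar>?T - ?o\<bar> \<le> real k * (R + (real k + 3) * \<epsilon> / 3)"
    by (intro mult_left_mono T) auto
  moreover have "\<bar>real k * ?T - (real k + 2) * ?o\<bar> \<le> real k * \<bar>?T - ?o\<bar> + 2 * \<bar>?o\<bar>"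
  proof -
    have "real k * ?T - (real k + 2) * ?o = real k * (?T - ?o) - 2 * ?o" by (simp add: algebra_simps)
    then show ?thesis using abs_triangle_ineq4[of "real k * (?T - ?o)" "2 * ?o"] by (simp add: abs_mult)
  qed
  \<comment> \<open>The new Q is a convex combination of T, with weight k/(k+2), and of the anchor
    0, which is at distance at most R from the optimum. The \<epsilon>-terms close since k(k+3) <=
    (k+1)(k+2).\<close>
  moreover have "real k * (R + (real k + 3) * \<epsilon> / 3) + 2 * R \<le> (real k + 2) * (R + real (Suc k) * \<epsilon> / 3)"
    using eps_pos by (simp add: algebra_simps)
  ultimately have "\<bar>real k * ?T - (real k + 2) * ?o\<bar> \<le> (real k + 2) * (R + real (Suc k) * \<epsilon> / 3)"
    using norm_SA_ge[OF sa, of "opt_value M"] by linarith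
  moreover have "real k * ?T - (real k + 2) * ?o = (real k + 2) * (cur_Q ?st s a - ?o)"
    by (simp add: update_def next_Q_def \<beta>_seq_def field_simps)
  ultimately have "(real k + 2) * \<bar>cur_Q ?st s a - ?o\<bar> \<le> (real k + 2) * (R + real (Suc k) * \<epsilon> / 3)"
    by (simp add: abs_mult)
  then show "\<bar>cur_Q ?st s a - ?o\<bar> \<le> R + real (Suc k) * \<epsilon> / 3"
    by (rule mult_left_le_imp_le) simp
  have "\<bar>\<gamma> * D s a\<bar> \<le> norm_S M (increment k st)"
  proof -
    have "\<bar>\<gamma> * D s a\<bar> \<le> \<bar>D s a\<bar>"
      using discount_pos discount_less_1 by (simp add: abs_mult mult_left_le_one_le)
    then show ?thesis using set_SAMPLE[OF D batch_ge_1 sa] by linarith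
  qed
  then have "(real k + 1) * (real k + 2) * \<bar>\<gamma> * D s a\<bar> \<le> (real k + 1) * (real k + 2) * norm_S M (increment k st)"
    by (intro mult_left_mono) auto
  then have gD: "(real k + 1) * (real k + 2) * \<bar>\<gamma> * D s a\<bar> \<le> 4 * R * real k + \<epsilon> * ((real k)\<^sup>2 + 5 * real k) / 3"
    using invariant_increment(1)[OF inv] by linarith
  \<comment> \<open>With \<beta> = k/(k+2), the weight (k+1)(k+2) is the one for which the sampled
    increment carries over with its old weight. The change of \<beta> leaves 2T, since (k+1)(k+2) -
    k(k+3) = 2.\<close>
  have Q_diff: "(real k + 2) * (real k + 3) * (next_Q (Suc k) ?st s a - cur_Q ?st s a)
      = (real k + 1) * (real k + 2) * (\<gamma> * D s a) + 2 * ?T"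
    by (simp add: update_def next_Q_def \<beta>_seq_def divide_simps) (simp add: algebra_simps)
  have "(real k + 2) * (real k + 3) * \<bar>next_Q (Suc k) ?st s a - cur_Q ?st s a\<bar>
      = \<bar>(real k + 2) * (real k + 3) * (next_Q (Suc k) ?st s a - cur_Q ?st s a)\<bar>"
    by (simp add: abs_mult)
  also have "\<dots> = \<bar>(real k + 1) * (real k + 2) * (\<gamma> * D s a) + 2 * ?T\<bar>"
    by (simp only: Q_diff)
  also have "\<dots> \<le> (real k + 1) * (real k + 2) * \<bar>\<gamma> * D s a\<bar> + 2 * \<bar>?T\<bar>"
    using abs_triangle_ineq[of "(real k + 1) * (real k + 2) * (\<gamma> * D s a)" "2 * ?T"] by (simp add: abs_mult)
  also have "\<dots> \<le> 4 * R * real k + \<epsilon> * ((real k)\<^sup>2 + 5 * real k) / 3 + 2 * (2 * R + (real k + 3) * \<epsilon> / 3)"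
    by (intro add_mono mult_left_mono gD T(2)) auto
  \<comment> \<open>The invariant's right-hand side is the sum of the added terms 4R +
    2(j+3)\<epsilon>/3 over j < k.\<close>
  also have "\<dots> = 4 * R * real (Suc k) + \<epsilon> * ((real (Suc k))\<^sup>2 + 5 * real (Suc k)) / 3"
    by (simp add: power2_eq_square algebra_simps add_divide_distrib)
  finally show "(real (Suc k) + 1) * (real (Suc k) + 2) * \<bar>next_Q (Suc k) ?st s a - cur_Q ?st s a\<bar> \<le> \<dots>"
    by (simp add: algebra_simps)
next
  let ?y = "4 * R / (real k + 2) + \<epsilon>"
  have "real (batch k st) \<le> 2 * \<alpha> * c_seq k * ?y\<^sup>2 / \<epsilon>\<^sup>2 + 1"
  proof -
    have "2 * \<alpha> * c_seq k * (norm_S M (increment k st))\<^sup>2 / \<epsilon>\<^sup>2 \<le> 2 * \<alpha> * c_seq k * ?y\<^sup>2 / \<epsilon>\<^sup>2"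
      using alpha_pos c_seq_pos[of k] invariant_increment(2)[OF inv] norm_S_nonneg
      by (intro divide_right_mono mult_left_mono power_mono) auto
    then show ?thesis using batch_le[of k st] by linarith
  qed
  then have "real (n_SA M) * real (batch k st) \<le> real (n_SA M) * (2 * \<alpha> * c_seq k * ?y\<^sup>2 / \<epsilon>\<^sup>2 + 1)"
    by (intro mult_left_mono) auto
  then show "real (n_samples (update k st D)) \<le> real (n_SA M) *
        (\<Sum>j<Suc k. 2 * \<alpha> * c_seq j * (4 * R / (real j + 2) + \<epsilon>)\<^sup>2 / \<epsilon>\<^sup>2 + 1)"
    using inv by (simp add: invariant_def update_def distrib_left)
next
  have n: "n_samples (update k st D) = n_samples st + n_SA M * batch k st"
    and t: "n_steps (update k st D) = n_steps st + 4 * n_SA M + 2 * card S + 1 + 2 * (n_SA M * batch k st)"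
    by (simp_all add: update_def)
  have b: "n_SA M \<le> n_SA M * batch k st" using batch_ge_1[of k st] by simp
  have "n_steps st \<le> 9 * n_samples st + 3 * n_SA M" "k * n_SA M \<le> n_samples st"
    using inv by (simp_all add: invariant_def)
  note bounds = this b card_S_le n_SA_pos
  \<comment> \<open>A batch draws at least one sample per pair, so the table work 4N + 2c + 1 is at
    most 7X; with 2X for the sampling itself this gives 9 steps per sample.\<close>
  have "t + 4 * N + 2 * c + 1 + 2 * X \<le> 9 * (n + X) + 3 * N"
    if "t \<le> 9 * n + 3 * N" "N \<le> X" "c \<le> N" "0 < N" for t n N X c :: nat
    using that by presburger
  from this[OF bounds(1,3,4,5)]
  show "n_steps (update k st D) \<le> 9 * n_samples (update k st D) + 3 * n_SA M"
    unfolding n t .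
  show "Suc k * n_SA M \<le> n_samples (update k st D)"
    unfolding n mult_Suc using bounds by linarith
qed (use good in \<open>auto simp: update_def\<close>)

text \<open>Failure after k + 1 iterations means failure after k or a new state that is not good.
  Only the law of the state at each single time is used, so no measure on whole runs is
  needed.\<close>

lemma prob_not_invariant:
  "measure_pmf.prob (iter k) {st. \<not> invariant k st} \<le> real k * (real (n_SA M) * (2 * exp (- \<alpha>)))"
proof (induction k)
  case 0
  then show ?case by (simp add: invariant_init)
next
  case (Suc k)
  have le: "emeasure (step k st) {st. \<not> invariant (Suc k) st}
      \<le> indicator {st. \<not> invariant k st} st + emeasure (step k st) {st. \<not> good st}" for st
  proof (cases "invariant k st")
    case True
    then have "AE st' in step k st. st' \<in> {st. \<not> invariant (Suc k) st} \<longrightarrow> st' \<in> {st. \<not> good st}"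
      by (auto simp: AE_measure_pmf_iff step_eq intro: invariant_update)
    then have "emeasure (step k st) {st. \<not> invariant (Suc k) st} \<le> emeasure (step k st) {st. \<not> good st}"
      by (intro emeasure_mono_AE) auto
    then show ?thesis using True by simp
  next
    case False
    then show ?thesis by (simp add: add_increasing2 measure_pmf.emeasure_le_1)
  qed
  have "emeasure (iter (Suc k)) {st. \<not> invariant (Suc k) st}
      = (\<integral>\<^sup>+st. emeasure (step k st) {st. \<not> invariant (Suc k) st} \<partial>iter k)"
    by simp
  also have "\<dots> \<le> (\<integral>\<^sup>+st. indicator {st. \<not> invariant k st} st + emeasure (step k st) {st. \<not> good st} \<partial>iter k)"
    by (intro nn_integral_mono le)
  also have "\<dots> = emeasure (iter k) {st. \<not> invariant k st} + emeasure (iter (Suc k)) {st. \<not> good st}"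
    by (subst nn_integral_add) auto
  finally have "measure_pmf.prob (iter (Suc k)) {st. \<not> invariant (Suc k) st}
      \<le> measure_pmf.prob (iter k) {st. \<not> invariant k st} + measure_pmf.prob (iter (Suc k)) {st. \<not> good st}"
    by (simp add: measure_pmf.emeasure_eq_measure flip: ennreal_plus del: savid_iter.simps)
  also have "\<dots> \<le> real k * (real (n_SA M) * (2 * exp (- \<alpha>))) + real (n_SA M) * (2 * exp (- \<alpha>))"
    using Suc.IH prob_not_good by (rule add_mono)
  finally show ?case by (simp add: algebra_simps)
qed

text \<open>As \<open>next_Q\<close> is k/(k+2) times T, the gap from T to Q is the known increment
  of Q plus the anchor gap 2T/(k+2). The same invariant therefore controls the residual, without
  another sampling step.\<close>

lemma invariant_residual:
  assumes inv: "invariant k st"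
  shows "norm_SA M (\<lambda>s a. cur_Q st s a - cur_T st s a) \<le> 8 * R / (real k + 2) + 2 * \<epsilon>"
  unfolding norm_SA_le_iff
proof (intro ballI)
  fix s a assume sa: "s \<in> S" "a \<in> A"
  let ?T = "cur_T st s a" and ?p = "(real k + 1) * (real k + 2)"
  have p: "0 < ?p" by (simp add: add_pos_pos)
  have T: "\<bar>?T\<bar> \<le> 2 * R + (real k + 3) * \<epsilon> / 3"
    by (rule invariant_cur_T[OF inv sa])
  have diff: "?p * \<bar>next_Q k st s a - cur_Q st s a\<bar> \<le> 4 * R * real k + \<epsilon> * ((real k)\<^sup>2 + 5 * real k) / 3"
    using inv sa by (auto simp: invariant_def)
  have "?p * \<bar>cur_Q st s a - ?T\<bar> = \<bar>?p * (next_Q k st s a - cur_Q st s a) + 2 * (real k + 1) * ?T\<bar>"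
  proof -
    have "?p * (cur_Q st s a - ?T) = - (?p * (next_Q k st s a - cur_Q st s a) + 2 * (real k + 1) * ?T)"
      by (simp add: next_Q_def \<beta>_seq_def divide_simps) (simp add: algebra_simps)
    then have "\<bar>?p * (cur_Q st s a - ?T)\<bar> = \<bar>?p * (next_Q k st s a - cur_Q st s a) + 2 * (real k + 1) * ?T\<bar>"
      by (simp only: abs_minus_cancel)
    then show ?thesis using p by (simp add: abs_mult)
  qed
  also have "\<dots> \<le> ?p * \<bar>next_Q k st s a - cur_Q st s a\<bar> + 2 * (real k + 1) * \<bar>?T\<bar>"
    using abs_triangle_ineq[of "?p * (next_Q k st s a - cur_Q st s a)" "2 * (real k + 1) * ?T"] by (simp add: abs_mult)
  also have "\<dots> \<le> (4 * R * real k + \<epsilon> * ((real k)\<^sup>2 + 5 * real k) / 3) + 2 * (real k + 1) * (2 * R + (real k + 3) * \<epsilon> / 3)"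
    using T by (intro add_mono diff mult_left_mono) auto
  also have "\<dots> \<le> 8 * R * (real k + 1) + 2 * \<epsilon> * ?p"
    using R_nonneg eps_pos by (simp add: power2_eq_square algebra_simps add_divide_distrib)
  also have "\<dots> = ?p * (8 * R / (real k + 2) + 2 * \<epsilon>)"
    by (simp add: field_simps)
  finally show "\<bar>cur_Q st s a - ?T\<bar> \<le> 8 * R / (real k + 2) + 2 * \<epsilon>"
    using p by (meson mult_le_cancel_left_pos)
qed

lemma good_bellman_residual:
  assumes "good st" "norm_SA M (\<lambda>s a. cur_Q st s a - cur_T st s a) \<le> b"
  shows "norm_SA M (\<lambda>s a. cur_Q st s a - bellman M (cur_Q st) s a) \<le> b + \<epsilon>"
  using assms unfolding norm_SA_le_iff good_def bias_def by (smt (verit))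

end

section \<open>Summing the batch sizes of one run\<close>

lemma square_sum_le: "(x + y)\<^sup>2 \<le> 2 * x\<^sup>2 + 2 * y\<^sup>2" for x y :: real
  using sum_squares_bound[of x y] by (simp add: power2_sum)

lemma sum_inverse_le_ln: "(\<Sum>j<k. 1 / (real j + 2)) \<le> ln (real k + 1)"
proof (induction k)
  case (Suc k)
  have "ln ((real k + 1) / (real k + 2)) \<le> (real k + 1) / (real k + 2) - 1"
    by (intro ln_le_minus_one) auto
  then have "1 / (real k + 2) \<le> ln (real k + 2) - ln (real k + 1)"
    by (simp add: ln_div field_simps)
  then show ?case using Suc by (simp add: add_ac)
qed simp

text \<open>The factor j + 2 in \<open>c_seq\<close> meets the squared decay R^2/(j+2)^2 and leaves
  a harmonic sum, hence a third logarithm besides the two in \<open>c_seq\<close>. The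
  \<epsilon>-part sums to order (n\<epsilon>)^2, which is O(R^2), and rounding the batches up costs
  n + 1. The constant 650 rounds up 2 * 320 + 4.\<close>

lemma sum_batch_bound:
  fixes \<alpha> R \<epsilon> :: real
  assumes n: "1 \<le> n" "real n * \<epsilon> \<le> 2 * R" and \<epsilon>: "0 < \<epsilon>" "\<epsilon> \<le> 1" and R: "1 \<le> R" and \<alpha>: "1 \<le> \<alpha>"
  shows "(\<Sum>j<Suc n. 2 * \<alpha> * c_seq j * (4 * R / (real j + 2) + \<epsilon>)\<^sup>2 / \<epsilon>\<^sup>2 + 1)
    \<le> 650 * \<alpha> * R\<^sup>2 * ln (real n + 2) ^ 3 / \<epsilon>\<^sup>2"
proof -
  let ?L = "ln (real n + 2)"
  have L: "1 \<le> ?L"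
  proof -
    have "exp 1 \<le> (3::real)" by (rule exp_le)
    then have "exp 1 \<le> real n + 2" using n by linarith
    then show ?thesis by (subst ln_ge_iff) auto
  qed
  have summand: "c_seq j * (4 * R / (real j + 2) + \<epsilon>)\<^sup>2 \<le> 5 * ?L\<^sup>2 * (32 * R\<^sup>2 * (1 / (real j + 2)) + 2 * \<epsilon>\<^sup>2 * (real n + 2))"
    if "j < Suc n" for j
  proof -
    have "(4 * R / (real j + 2) + \<epsilon>)\<^sup>2 \<le> 2 * (4 * R / (real j + 2))\<^sup>2 + 2 * \<epsilon>\<^sup>2"
      by (rule square_sum_le)
    then have "(real j + 2) * (4 * R / (real j + 2) + \<epsilon>)\<^sup>2 \<le> (real j + 2) * (2 * (4 * R / (real j + 2))\<^sup>2 + 2 * \<epsilon>\<^sup>2)"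
      by (intro mult_left_mono) auto
    also have "\<dots> = 32 * R\<^sup>2 * (1 / (real j + 2)) + 2 * \<epsilon>\<^sup>2 * (real j + 2)"
    proof -
      have "q * (2 * (4 * R / q)\<^sup>2 + 2 * \<epsilon>\<^sup>2) = 32 * R\<^sup>2 * (1 / q) + 2 * \<epsilon>\<^sup>2 * q" if "q \<noteq> 0" for q :: real
        using that by (simp add: power2_eq_square field_simps)
      then show ?thesis by simp
    qed
    also have "\<dots> \<le> 32 * R\<^sup>2 * (1 / (real j + 2)) + 2 * \<epsilon>\<^sup>2 * (real n + 2)"
      using that by (intro add_left_mono mult_left_mono) auto
    finally have *: "(real j + 2) * (4 * R / (real j + 2) + \<epsilon>)\<^sup>2 \<le> \<dots>" .
    have "(ln (real j + 2))\<^sup>2 \<le> ?L\<^sup>2" using that by (intro power_mono) auto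
    with * have "(5 * (ln (real j + 2))\<^sup>2) * ((real j + 2) * (4 * R / (real j + 2) + \<epsilon>)\<^sup>2)
        \<le> (5 * ?L\<^sup>2) * (32 * R\<^sup>2 * (1 / (real j + 2)) + 2 * \<epsilon>\<^sup>2 * (real n + 2))"
      by (intro mult_mono) auto
    then show ?thesis by (simp only: c_seq_def mult_ac)
  qed
  have en: "\<epsilon> * (real n + 2) \<le> 4 * R" using n \<epsilon> R by (simp add: algebra_simps)
  have "(\<Sum>j<Suc n. c_seq j * (4 * R / (real j + 2) + \<epsilon>)\<^sup>2)
      \<le> (\<Sum>j<Suc n. 5 * ?L\<^sup>2 * (32 * R\<^sup>2 * (1 / (real j + 2)) + 2 * \<epsilon>\<^sup>2 * (real n + 2)))"
    by (intro sum_mono summand) auto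
  also have "\<dots> = 5 * ?L\<^sup>2 * (32 * R\<^sup>2 * (\<Sum>j<Suc n. 1 / (real j + 2)) + (real n + 1) * (2 * \<epsilon>\<^sup>2 * (real n + 2)))"
    by (simp only: sum.distrib flip: sum_distrib_left) (simp add: algebra_simps)
  also have "\<dots> \<le> 5 * ?L\<^sup>2 * (32 * R\<^sup>2 * ?L + 32 * R\<^sup>2 * ?L)"
  proof (intro mult_left_mono add_mono)
    show "(\<Sum>j<Suc n. 1 / (real j + 2)) \<le> ?L"
      using sum_inverse_le_ln[of "Suc n"] by (simp add: add_ac)
    have "(real n + 1) * (2 * \<epsilon>\<^sup>2 * (real n + 2)) \<le> 2 * (\<epsilon> * (real n + 2))\<^sup>2"
      using \<epsilon> by (simp add: power2_eq_square algebra_simps)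
    also have "\<dots> \<le> 2 * (4 * R)\<^sup>2"
      using en \<epsilon> by (intro mult_left_mono power_mono) auto
    also have "\<dots> \<le> 32 * R\<^sup>2 * ?L"
      using L mult_left_mono[OF L, of "32 * R\<^sup>2"] by (simp add: power_mult_distrib)
    finally show "(real n + 1) * (2 * \<epsilon>\<^sup>2 * (real n + 2)) \<le> 32 * R\<^sup>2 * ?L" .
  qed auto
  also have "\<dots> = 320 * R\<^sup>2 * ?L ^ 3"
    by (simp add: power2_eq_square power3_eq_cube)
  finally have main: "(\<Sum>j<Suc n. c_seq j * (4 * R / (real j + 2) + \<epsilon>)\<^sup>2) \<le> 320 * R\<^sup>2 * ?L ^ 3" .
  have "(real n + 1) * \<epsilon>\<^sup>2 \<le> 4 * (\<alpha> * R\<^sup>2 * ?L ^ 3)"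
  proof -
    have "(real n + 1) * \<epsilon>\<^sup>2 \<le> (real n + 1) * \<epsilon>"
      using \<epsilon> by (intro mult_left_mono) (auto simp: power2_eq_square mult_left_le)
    also have "\<dots> \<le> 4 * R" using en \<epsilon> by (simp add: algebra_simps)
    also have "\<dots> \<le> 4 * (1 * R\<^sup>2 * 1)" using R by (simp add: self_le_power)
    also have "\<dots> \<le> 4 * (\<alpha> * R\<^sup>2 * ?L ^ 3)"
      using \<alpha> L by (intro mult_left_mono mult_mono) (auto simp: one_le_power)
    finally show ?thesis .
  qed
  moreover have "2 * \<alpha> * (\<Sum>j<Suc n. c_seq j * (4 * R / (real j + 2) + \<epsilon>)\<^sup>2) \<le> 2 * \<alpha> * (320 * R\<^sup>2 * ?L ^ 3)"
    using \<alpha> by (intro mult_left_mono main) auto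
  moreover have "0 \<le> \<alpha> * R\<^sup>2 * ?L ^ 3" using \<alpha> L by simp
  ultimately have "2 * \<alpha> * (\<Sum>j<Suc n. c_seq j * (4 * R / (real j + 2) + \<epsilon>)\<^sup>2) + (real n + 1) * \<epsilon>\<^sup>2
      \<le> 650 * \<alpha> * R\<^sup>2 * ?L ^ 3"
    by (simp add: mult.assoc)
  then have "(2 * \<alpha> * (\<Sum>j<Suc n. c_seq j * (4 * R / (real j + 2) + \<epsilon>)\<^sup>2) + (real n + 1) * \<epsilon>\<^sup>2) / \<epsilon>\<^sup>2
      \<le> 650 * \<alpha> * R\<^sup>2 * ?L ^ 3 / \<epsilon>\<^sup>2"
    by (intro divide_right_mono) auto
  moreover have "(\<Sum>j<Suc n. 2 * \<alpha> * c_seq j * (4 * R / (real j + 2) + \<epsilon>)\<^sup>2 / \<epsilon>\<^sup>2 + 1)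
      = (2 * \<alpha> * (\<Sum>j<Suc n. c_seq j * (4 * R / (real j + 2) + \<epsilon>)\<^sup>2) + (real n + 1) * \<epsilon>\<^sup>2) / \<epsilon>\<^sup>2"
    using \<epsilon> by (simp add: sum.distrib sum_distrib_left sum_divide_distrib add_divide_distrib mult.assoc del: sum.lessThan_Suc)
  ultimately show ?thesis by simp
qed

section \<open>The doubling loop\<close>

lemma c_seq_mono: "i \<le> j \<Longrightarrow> c_seq i \<le> c_seq j"
  unfolding c_seq_def by (intro mult_mono power_mono) auto

lemma c_seq_ge_1: "1 \<le> c_seq k"
proof -
  have "(2 / 3)\<^sup>2 \<le> (ln (2::real))\<^sup>2"
    using ln2_ge_two_thirds by (intro power_mono) auto
  then have "1 \<le> c_seq 0" by (simp add: c_seq_def power2_eq_square)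
  then show ?thesis using c_seq_mono[of 0 k] by simp
qed

lemma prob_bind_spmf_ge:
  fixes p :: "'b pmf" and f :: "'b \<Rightarrow> 'c spmf"
  assumes p: "measure_pmf.prob p {x. \<not> g x} \<le> a"
    and f: "\<And>x. x \<in> set_pmf p \<Longrightarrow> g x \<Longrightarrow> 1 - b \<le> measure (measure_spmf (f x)) G"
    and "0 \<le> b"
  shows "1 - (a + b) \<le> measure (measure_spmf (bind_pmf p f)) G"
proof -
  let ?X = "- (Some ` G)"
  have le: "emeasure (f x) ?X \<le> indicator {x. \<not> g x} x + ennreal b" if "x \<in> set_pmf p" for x
  proof (cases "g x")
    case True
    have "measure_pmf.prob (f x) ?X \<le> b"
      using f[OF that True] measure_pmf.prob_compl[of "Some ` G" "f x"]
      by (simp add: measure_measure_spmf_conv_measure_pmf Compl_eq_Diff_UNIV)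
    then show ?thesis
      using True by (simp add: measure_pmf.emeasure_eq_measure ennreal_leI)
  next
    case False
    then show ?thesis by (simp add: add_increasing2 measure_pmf.emeasure_le_1)
  qed
  have "emeasure (bind_pmf p f) ?X = (\<integral>\<^sup>+x. emeasure (f x) ?X \<partial>p)"
    by simp
  also have "\<dots> \<le> (\<integral>\<^sup>+x. indicator {x. \<not> g x} x + ennreal b \<partial>p)"
    by (intro nn_integral_mono_AE AE_pmfI le)
  also have "\<dots> = emeasure p {x. \<not> g x} + ennreal b"
    by (subst nn_integral_add) (auto simp: measure_pmf.emeasure_space_1[simplified])
  finally have "measure_pmf.prob (bind_pmf p f) ?X \<le> measure_pmf.prob p {x. \<not> g x} + b"
    using \<open>0 \<le> b\<close> by (simp add: measure_pmf.emeasure_eq_measure flip: ennreal_plus)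
  then show ?thesis
    using p measure_pmf.prob_compl[of "Some ` G" "bind_pmf p f"]
    by (simp add: measure_measure_spmf_conv_measure_pmf Compl_eq_Diff_UNIV)
qed

section \<open>Success of a single loop and of the whole sequence of loops\<close>

context unit_reward_mdp
begin

abbreviation "loop_bound n \<epsilon> \<delta> \<equiv>
  real (n_SA M) * (650 * ln (2 * real (n_SA M) * (real n + 1) / \<delta>) * (norm_SA M (opt_value M))\<^sup>2 *
    ln (real n + 2) ^ 3 / \<epsilon>\<^sup>2)"

text \<open>The first residual bound certifies the output if the loop stops, the second forces it to
  stop once n is large. The denominator n + 3 is k + 2 for the k = n + 1 iterations of a run, and
  the time includes the stopping test.\<close>

definition loop_good ::
  "(('s \<Rightarrow> 'a \<Rightarrow> real) \<Rightarrow> 's \<Rightarrow> 'a) \<Rightarrow> nat \<Rightarrow> real \<Rightarrow> real \<Rightarrow> ('s, 'a) savid_output \<Rightarrow> bool" where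
  "loop_good sel n \<epsilon> \<delta> out \<longleftrightarrow>
     out_policy out = sel (out_Q out) \<and>
     norm_SA M (\<lambda>s a. out_Q out s a - bellman M (out_Q out) s a)
       \<le> norm_SA M (\<lambda>s a. out_Q out s a - out_T out s a) + \<epsilon> \<and>
     norm_SA M (\<lambda>s a. out_Q out s a - out_T out s a)
       \<le> 8 * norm_SA M (opt_value M) / (real n + 3) + 2 * \<epsilon> \<and>
     real (samples out) \<le> loop_bound n \<epsilon> \<delta> \<and>
     run_time out + n_SA M + 2 \<le> 16 * samples out"

text \<open>The value of \<open>\<alpha>\<close> makes the union bound over n + 1 iterations, all
  pairs and both signs equal to \<delta>. It is at least 1, which absorbs the rounding of the batch
  sizes.\<close>

lemma prob_SAVID_not_good:
  assumes n: "1 \<le> n" "real n * \<epsilon> \<le> 2 * norm_SA M (opt_value M)"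
    and \<epsilon>: "0 < \<epsilon>" "\<epsilon> \<le> 1" and \<delta>: "0 < \<delta>" "\<delta> \<le> 1"
    and R: "1 \<le> norm_SA M (opt_value M)"
  shows "measure_pmf.prob (SAVID M sel c_seq \<beta>_seq (\<lambda>_ _. 0) n \<epsilon> \<delta>) {out. \<not> loop_good sel n \<epsilon> \<delta> out} \<le> \<delta>"
proof -
  define \<alpha> where "\<alpha> = ln (2 * real (n_SA M) * (real n + 1) / \<delta>)"
  note N = real_n_SA_ge_1
  have arg: "4 \<le> 2 * real (n_SA M) * (real n + 1) / \<delta>"
  proof -
    have "2 * 1 * 2 \<le> 2 * real (n_SA M) * (real n + 1)"
      using N n by (intro mult_mono) auto
    then show ?thesis
      using \<delta> by (simp add: pos_le_divide_eq)
  qed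
  have \<alpha>: "1 \<le> \<alpha>"
  proof -
    have "exp 1 \<le> 2 * real (n_SA M) * (real n + 1) / \<delta>"
      using arg exp_le by linarith
    then show ?thesis using arg unfolding \<alpha>_def by (subst ln_ge_iff) auto
  qed
  interpret savid_run M \<epsilon> \<alpha>
    by unfold_locales (use \<epsilon> \<alpha> in auto)
  define out where "out st = \<lparr>out_Q = cur_Q st, out_T = cur_T st, out_policy = sel (cur_Q st),
      samples = n_samples st, run_time = n_steps st + n_SA M\<rparr>" for st :: "('s, 'a) savid_state"
  have SAVID_eq: "SAVID M sel c_seq \<beta>_seq (\<lambda>_ _. 0) n \<epsilon> \<delta> = map_pmf out (iter (Suc n))"
    unfolding SAVID_def \<alpha>_def[symmetric] Let_def out_def ..
  have "loop_good sel n \<epsilon> \<delta> (out st)" if inv: "invariant (Suc n) st" for st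
  proof -
    have "good st" using inv by (simp add: invariant_def)
    moreover have "real (n_samples st) \<le> real (n_SA M) * (\<Sum>j<Suc n. 2 * \<alpha> * c_seq j * (4 * R / (real j + 2) + \<epsilon>)\<^sup>2 / \<epsilon>\<^sup>2 + 1)"
      using inv by (auto simp only: invariant_def)
    moreover have "real (n_SA M) * (\<Sum>j<Suc n. 2 * \<alpha> * c_seq j * (4 * R / (real j + 2) + \<epsilon>)\<^sup>2 / \<epsilon>\<^sup>2 + 1)
        \<le> real (n_SA M) * (650 * \<alpha> * R\<^sup>2 * ln (real n + 2) ^ 3 / \<epsilon>\<^sup>2)"
      using n \<epsilon> \<open>1 \<le> R\<close> \<alpha> by (intro mult_left_mono sum_batch_bound) auto
    \<comment> \<open>Beyond 9 steps per sample there remain at most 5N + 2 <= 7N steps, and a run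
      draws at least N samples: 9 + 7 = 16.\<close>
    moreover have "n_steps st + n_SA M + n_SA M + 2 \<le> 16 * n_samples st"
    proof -
      have "n_steps st \<le> 9 * n_samples st + 3 * n_SA M" "Suc n * n_SA M \<le> n_samples st"
        using inv by (auto simp only: invariant_def)
      then show ?thesis using n_SA_pos by simp
    qed
    ultimately show ?thesis
      using invariant_residual[OF inv] good_bellman_residual[OF _ order_refl, of st]
      unfolding loop_good_def out_def \<alpha>_def[symmetric] by (simp add: add_ac del: sum.lessThan_Suc)
  qed
  then have "measure_pmf.prob (SAVID M sel c_seq \<beta>_seq (\<lambda>_ _. 0) n \<epsilon> \<delta>) {out. \<not> loop_good sel n \<epsilon> \<delta> out}
      \<le> measure_pmf.prob (iter (Suc n)) {st. \<not> invariant (Suc n) st}"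
    unfolding SAVID_eq measure_map_pmf by (intro measure_pmf.finite_measure_mono) auto
  also have "\<dots> \<le> real (Suc n) * (real (n_SA M) * (2 * exp (- \<alpha>)))"
    by (rule prob_not_invariant)
  also have "exp (- \<alpha>) = \<delta> / (2 * real (n_SA M) * (real n + 1))"
    using arg unfolding \<alpha>_def exp_minus by (subst exp_ln) auto
  also have "real (Suc n) * (real (n_SA M) * (2 * (\<delta> / (2 * real (n_SA M) * (real n + 1))))) = \<delta>"
  proof -
    have "p * (q * (2 * (\<delta> / (2 * q * p)))) = \<delta>" if "p \<noteq> 0" "q \<noteq> 0" for p q :: real
      using that by simp
    from this[of "real n + 1" "real (n_SA M)"] show ?thesis using N by (simp add: add.commute)
  qed
  finally show ?thesis .
qed

text \<open>Induction runs downwards from I, where a good loop must stop, so the recursion is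
  unfolded finitely often and termination comes out as part of the probability bound. B bounds the
  cost of every loop up to I, which makes i * B a valid budget before loop i.\<close>

lemma prob_SAVID_plus_from:
  fixes I :: nat and \<epsilon> \<delta> :: real
  defines "B \<equiv> loop_bound (2 ^ I) \<epsilon> (\<delta> / c_seq I)"
  assumes I: "norm_SA M (opt_value M) \<le> 2 ^ I * \<epsilon>" "2 ^ I * \<epsilon> \<le> 2 * norm_SA M (opt_value M)"
    and \<epsilon>: "0 < \<epsilon>" "\<epsilon> \<le> 1" and \<delta>: "0 < \<delta>" "\<delta> \<le> 1"
    and R: "1 \<le> norm_SA M (opt_value M)"
    and "i \<le> I" "real u \<le> real i * B" "t \<le> 16 * u"
  shows "1 - (\<Sum>j=i..I. \<delta> / c_seq j) \<le>
    measure (measure_spmf (savid_plus_from M sel c_seq \<beta>_seq (\<lambda>_ _. 0) \<epsilon> \<delta> i u t))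
      {out. out_policy out = sel (out_Q out) \<and>
        norm_SA M (\<lambda>s a. out_Q out s a - bellman M (out_Q out) s a) \<le> 12 * \<epsilon> \<and>
        real (samples out) \<le> (real I + 1) * B \<and> run_time out \<le> 16 * samples out}"
    (is "_ \<le> measure _ ?G")
  using \<open>i \<le> I\<close> assms(10-)
proof (induction i arbitrary: u t rule: inc_induct)
  note N = real_n_SA_ge_1
  \<comment> \<open>From loop to loop n grows and the allowed failure probability shrinks, so both
    logarithms increase.\<close>
  have B: "loop_bound (2 ^ i) \<epsilon> (\<delta> / c_seq i) \<le> B" if "i \<le> I" for i
  proof -
    have p: "(2::real) ^ i \<le> 2 ^ I" using that by (intro power_increasing) auto
    have "0 < 2 * real (n_SA M) * (2 ^ i + 1) / (\<delta> / c_seq i)"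
      using N \<delta> c_seq_pos[of i] by (intro divide_pos_pos mult_pos_pos add_pos_pos) auto
    moreover have "2 * real (n_SA M) * (2 ^ i + 1) * c_seq i \<le> 2 * real (n_SA M) * (2 ^ I + 1) * c_seq I"
      using p c_seq_mono[OF that] c_seq_pos[of i] by (intro mult_mono) auto
    then have "2 * real (n_SA M) * (2 ^ i + 1) / (\<delta> / c_seq i) \<le> 2 * real (n_SA M) * (2 ^ I + 1) / (\<delta> / c_seq I)"
      using \<delta> by (simp add: divide_right_mono)
    ultimately have a: "ln (2 * real (n_SA M) * (2 ^ i + 1) / (\<delta> / c_seq i)) \<le> ln (2 * real (n_SA M) * (2 ^ I + 1) / (\<delta> / c_seq I))"
      by (simp only: ln_mono)
    have "1 * 1 \<le> 2 * real (n_SA M) * (2 ^ I + 1) / \<delta> * c_seq I"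
    proof (intro mult_mono c_seq_ge_1)
      have "1 * 1 \<le> 2 * real (n_SA M) * (2 ^ I + 1)" using N by (intro mult_mono) auto
      then show "1 \<le> 2 * real (n_SA M) * (2 ^ I + 1) / \<delta>" using \<delta> by (simp add: pos_le_divide_eq)
    qed (use N \<delta> in auto)
    then have "0 \<le> ln (2 * real (n_SA M) * (2 ^ I + 1) / (\<delta> / c_seq I))"
      by (intro ln_ge_zero) simp
    moreover have "ln ((2::real) ^ i + 2) \<le> ln (2 ^ I + 2)"
      using p by (intro ln_mono) (auto simp: add_pos_pos)
    ultimately show ?thesis using a R unfolding B_def
      by (intro mult_left_mono divide_right_mono mult_mono power_mono) auto
  qed
  have loop: "1 - (\<delta> / c_seq i + b) \<le> measure (measure_spmf (savid_plus_from M sel c_seq \<beta>_seq (\<lambda>_ _. 0) \<epsilon> \<delta> i u t)) ?G"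
    if i: "i \<le> I" and u: "real u \<le> real i * B" and t: "t \<le> 16 * u" and b: "0 \<le> b"
      and rest: "\<And>u t. i < I \<Longrightarrow> real u \<le> real (Suc i) * B \<Longrightarrow> t \<le> 16 * u \<Longrightarrow>
        1 - b \<le> measure (measure_spmf (savid_plus_from M sel c_seq \<beta>_seq (\<lambda>_ _. 0) \<epsilon> \<delta> (Suc i) u t)) ?G"
    for i u t b
  proof (subst savid_plus_from.simps, unfold bind_spmf_of_pmf, rule prob_bind_spmf_ge[where g="loop_good sel (2 ^ i) \<epsilon> (\<delta> / c_seq i)"])
    have "(2::real) ^ i * \<epsilon> \<le> 2 ^ I * \<epsilon>"
      using i \<epsilon> by (intro mult_right_mono power_increasing) auto
    then have "2 ^ i * \<epsilon> \<le> 2 * norm_SA M (opt_value M)" using I by linarith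
    then show "measure_pmf.prob (SAVID M sel c_seq \<beta>_seq (\<lambda>_ _. 0) (2 ^ i) \<epsilon> (\<delta> / c_seq i))
        {out. \<not> loop_good sel (2 ^ i) \<epsilon> (\<delta> / c_seq i) out} \<le> \<delta> / c_seq i"
      using I \<epsilon> \<delta> R c_seq_ge_1[of i] c_seq_pos[of i]
      by (intro prob_SAVID_not_good) (auto simp: divide_le_eq)
  next
    fix out assume good: "loop_good sel (2 ^ i) \<epsilon> (\<delta> / c_seq i) out"
    let ?u = "u + samples out" and ?t = "t + run_time out + n_SA M + 2"
    let ?res = "norm_SA M (\<lambda>s a. out_Q out s a - out_T out s a)"
    have "real (samples out) \<le> B" using good B[OF i] unfolding loop_good_def by linarith
    then have u': "real ?u \<le> real (Suc i) * B" using u by (simp add: algebra_simps)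
    have t': "?t \<le> 16 * ?u" using t good by (simp add: loop_good_def)
    have B0: "0 \<le> B" using \<open>real (samples out) \<le> B\<close> by linarith
    show "1 - b \<le> measure (measure_spmf
        (let u' = u + samples out; t' = t + run_time out + n_SA M + 2
         in if ?res \<le> 11 * \<epsilon> then return_spmf (out\<lparr>samples := u', run_time := t'\<rparr>)
            else savid_plus_from M sel c_seq \<beta>_seq (\<lambda>_ _. 0) \<epsilon> \<delta> (Suc i) u' t')) ?G"
    proof (cases "?res \<le> 11 * \<epsilon>")
      case True
      have "real (Suc i) * B \<le> (real I + 1) * B" using i B0 by (intro mult_right_mono) auto
      then have "out\<lparr>samples := ?u, run_time := ?t\<rparr> \<in> ?G"
        using True good u' t' by (simp add: loop_good_def)
      then have "measure (measure_spmf (return_spmf (out\<lparr>samples := ?u, run_time := ?t\<rparr>))) ?G = 1"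
        unfolding measure_measure_spmf_conv_measure_pmf measure_return_pmf by (simp only: indicator_simps image_eqI)
      then show ?thesis using True b by (simp add: Let_def)
    next
      case False
      \<comment> \<open>In loop I the residual is at most 8R/(2^I + 3) + 2\<epsilon> <=
        10\<epsilon>, within the threshold 11\<epsilon>.\<close>
      have "i \<noteq> I"
      proof
        assume "i = I"
        have "8 * norm_SA M (opt_value M) / (2 ^ I + 3) \<le> 8 * \<epsilon>"
          using I \<epsilon> by (simp add: divide_le_eq add_pos_pos algebra_simps)
        then have "?res \<le> 11 * \<epsilon>"
          using good \<epsilon> unfolding loop_good_def \<open>i = I\<close> by simp
        then show False using False by simp
      qed
      then show ?thesis using rest[OF _ u' t'] i False by (simp add: Let_def)
    qed
  qed (rule b)
  {
    \<comment> \<open>At i = I the premise \<open>rest\<close> is vacuous, so nothing is added to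
      the failure probability of this loop.\<close>
    case base
    then show ?case using loop[of I u t 0] by simp
  next
    case (step i)
    have "0 \<le> (\<Sum>j=Suc i..I. \<delta> / c_seq j)"
      using \<delta> c_seq_pos by (intro sum_nonneg) (simp add: less_imp_le)
    with step have "1 - (\<delta> / c_seq i + (\<Sum>j=Suc i..I. \<delta> / c_seq j)) \<le>
      measure (measure_spmf (savid_plus_from M sel c_seq \<beta>_seq (\<lambda>_ _. 0) \<epsilon> \<delta> i u t)) ?G"
      by (intro loop) auto
    then show ?case using \<open>i < I\<close> by (simp add: sum.atLeast_Suc_atMost)
  }
qed

end

text \<open>Everything follows from 48 x^2 <= (2x)^6, that is I ln 2 <= 6 ln(2x). The constants: 9 +
  3/2 rounded up to 11, using ln 2 >= 2/3; 6 + 2 = 8; and 1 + 7 + 4 * 6 = 32, where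
  \<open>c_seq I\<close> is bounded by a power of 2.\<close>

lemma log_factor_bounds:
  fixes x N \<delta> :: real
  assumes x: "1 \<le> x" and N: "1 \<le> N" and \<delta>: "0 < \<delta>" "\<delta> \<le> 1"
    and I: "2 ^ I \<le> 48 * x\<^sup>2"
  shows "real I + 1 \<le> 11 * ln (2 * x)"
    and "ln (2 ^ I + 2) \<le> 8 * ln (2 * x)"
    and "ln (2 * N * (2 ^ I + 1) / (\<delta> / c_seq I)) \<le> 32 * ln (2 * N * x / \<delta>)"
proof -
  let ?l = "ln (2 * x)"
  have ln2: "2 / 3 \<le> ln (2::real)" by (rule ln2_ge_two_thirds)
  have l: "ln 2 \<le> ?l" using x by simp
  have "48 * x\<^sup>2 \<le> (2 * x) ^ 6"
  proof -
    have "48 * x\<^sup>2 \<le> 64 * x ^ 6"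
      using x by (intro mult_mono power_increasing) auto
    then show ?thesis by (simp add: power_mult_distrib)
  qed
  then have "ln (2 ^ I) \<le> ln ((2 * x) ^ 6)"
    using I x by (subst ln_le_cancel_iff) auto
  then have I_ln: "real I * ln 2 \<le> 6 * ?l"
    unfolding ln_realpow of_nat_numeral .
  have "real I * (2 / 3) \<le> real I * ln 2"
    using ln2 by (intro mult_left_mono) auto
  then show "real I + 1 \<le> 11 * ?l" using I_ln ln2 l by linarith
  have "(1::real) \<le> 2 ^ I" "(2::real) ^ (I + 2) = 4 * 2 ^ I" by (simp_all add: power_add)
  then have "(2::real) ^ I + 2 \<le> 2 ^ (I + 2)" by linarith
  then have "ln ((2::real) ^ I + 2) \<le> ln (2 ^ (I + 2))"
    by (intro ln_mono) (auto simp: add_pos_pos)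
  also have "\<dots> = real I * ln 2 + 2 * ln 2"
    by (subst ln_realpow) (auto simp: algebra_simps)
  finally show "ln (2 ^ I + 2) \<le> 8 * ?l" using I_ln l by linarith
  have c: "c_seq I \<le> 2 ^ (6 + 3 * I)"
  proof -
    have q: "real I + 2 \<le> 2 * 2 ^ I"
    proof -
      have "I + 2 \<le> 2 * 2 ^ I"
        by (induction I) auto
      then have "real (I + 2) \<le> real (2 * 2 ^ I)" by (simp only: of_nat_le_iff)
      then show ?thesis by simp
    qed
    have "ln (real I + 2) \<le> real I + 2" by (rule ln_bound) simp
    then have "c_seq I \<le> 5 * (real I + 2) * (real I + 2)\<^sup>2"
      unfolding c_seq_def by (intro mult_left_mono power_mono) auto
    also have "\<dots> = 5 * (real I + 2) ^ 3" by (simp add: power3_eq_cube power2_eq_square)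
    also have "\<dots> \<le> 8 * (2 * 2 ^ I) ^ 3" using q by (intro mult_mono power_mono) auto
    also have "\<dots> = 2 ^ (6 + 3 * I)" by (simp add: power_add power_mult_distrib power_mult[symmetric] mult.commute)
    finally show ?thesis .
  qed
  have pos: "0 < 2 * N * (2 ^ I + 1) / (\<delta> / c_seq I)"
    using N \<delta> c_seq_pos[of I] by (intro divide_pos_pos mult_pos_pos add_pos_pos) auto
  have "2 * N * (2 ^ I + 1) / (\<delta> / c_seq I) = (2 * N / \<delta>) * ((2 ^ I + 1) * c_seq I)" by simp
  also have "\<dots> \<le> (2 * N / \<delta>) * (2 ^ (I + 1) * 2 ^ (6 + 3 * I))"
    using c N \<delta> c_seq_pos[of I] by (intro mult_left_mono mult_mono) auto
  also have "\<dots> = (2 * N / \<delta>) * 2 ^ (7 + 4 * I)"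
    by (simp only: power_add[symmetric]) (simp add: algebra_simps)
  finally have "ln (2 * N * (2 ^ I + 1) / (\<delta> / c_seq I)) \<le> ln ((2 * N / \<delta>) * 2 ^ (7 + 4 * I))"
    using pos by (simp only: ln_mono)
  also have "\<dots> = ln (2 * N / \<delta>) + ln (2 ^ (7 + 4 * I))"
    using N \<delta> by (intro ln_mult_pos) auto
  also have "ln ((2::real) ^ (7 + 4 * I)) = 7 * ln 2 + 4 * (real I * ln 2)"
    by (subst ln_realpow) (auto simp: algebra_simps)
  also have "ln (2 * N / \<delta>) + (7 * ln 2 + 4 * (real I * ln 2)) \<le> ln (2 * N / \<delta>) + 31 * ?l"
    using I_ln l by linarith
  also have "ln (2 * N / \<delta>) \<le> ln (2 * N * x / \<delta>)"
    using x N \<delta> by (simp add: divide_right_mono)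
  also have "?l \<le> ln (2 * N * x / \<delta>)"
  proof -
    have "2 * x * \<delta> \<le> 2 * x * N"
      using x N \<delta> by (intro mult_left_mono) auto
    then have "2 * x \<le> 2 * N * x / \<delta>" using \<delta> by (simp add: pos_le_divide_eq mult_ac)
    then show ?thesis using x by simp
  qed
  finally show "ln (2 * N * (2 ^ I + 1) / (\<delta> / c_seq I)) \<le> 32 * ln (2 * N * x / \<delta>)" by simp
qed

section \<open>Choice of the last loop and of the absolute constant\<close>

theorem theorem4p3:
  "\<exists>C::real. C > 0 \<and>
    (\<forall>(M :: ('s, 'a) mdp) sel \<epsilon> \<delta>.
       discounted_mdp M \<longrightarrow>
       (\<forall>s\<in>states M. \<forall>a\<in>actions M. 0 \<le> reward M s a \<and> reward M s a \<le> 1) \<longrightarrow>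
       1 \<le> norm_SA M (opt_value M) \<longrightarrow>
       argmax_rule M sel \<longrightarrow>
       0 < \<epsilon> \<longrightarrow> \<epsilon> \<le> 1 / (1 - discount M) \<longrightarrow>
       0 < \<delta> \<longrightarrow> \<delta> < 1 \<longrightarrow>
       measure (measure_spmf
           (SAVID_plus M sel c_seq \<beta>_seq (\<lambda>_ _. 0) (\<epsilon> * (1 - discount M) / 24) \<delta>))
         {out.
            norm_SA M (\<lambda>s a. opt_value M s a - policy_value M (out_policy out) s a)
              \<le> 2 / (1 - discount M) * norm_SA M (\<lambda>s a. out_Q out s a - bellman M (out_Q out) s a) \<and>
            2 / (1 - discount M) * norm_SA M (\<lambda>s a. out_Q out s a - bellman M (out_Q out) s a) \<le> \<epsilon> \<and>
            real (samples out) \<le> C * complexity_bound M \<epsilon> \<delta> \<and>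
            real (run_time out) \<le> C * complexity_bound M \<epsilon> \<delta>}
       \<ge> 1 - \<delta>)"
proof -
  \<comment> \<open>The factors bound one loop (650), its \<open>\<alpha>\<close> (32), its cubed logarithm (\<open>8\<^sup>3\<close>) and the number of
    loops (11); \<open>576 = 24\<^sup>2\<close> comes from rescaling \<open>\<epsilon>\<close>, and 16 below is the time per sample.\<close>
  define K :: real where "K = 650 * 32 * 512 * 11 * 576"
  show ?thesis
  proof (intro exI[of _ "16 * K"] conjI allI impI)
    fix M :: "('s, 'a) mdp" and sel and \<epsilon> \<delta> :: real
    assume M: "discounted_mdp M" "\<forall>s\<in>states M. \<forall>a\<in>actions M. 0 \<le> reward M s a \<and> reward M s a \<le> 1"
      and R1: "1 \<le> norm_SA M (opt_value M)" and sel: "argmax_rule M sel"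
      and \<epsilon>: "0 < \<epsilon>" "\<epsilon> \<le> 1 / (1 - discount M)" and \<delta>: "0 < \<delta>" "\<delta> < 1"
    interpret unit_reward_mdp M by unfold_locales (use M in auto)
    let ?R = "norm_SA M (opt_value M)" and ?N = "real (n_SA M)"
    define e where "e = \<epsilon> * (1 - \<gamma>) / 24"
    \<comment> \<open>The logarithms of the complexity bound are ln(2x) and ln(2Nx/\<delta>). The
      minimum makes x dominate both 1/(1-\<gamma>), hence the norm of the optimal value, and
      1/((1-\<gamma>)\<epsilon>).\<close>
    define x where "x = 1 / ((1 - \<gamma>) * min \<epsilon> 1)"
    have g: "0 < 1 - \<gamma>" "1 - \<gamma> \<le> 1" using discount_pos discount_less_1 by auto
    have e: "0 < e" "e \<le> 1 / 24" using \<epsilon> g by (auto simp: e_def field_simps)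
    have x: "1 \<le> x" "1 / (1 - \<gamma>) \<le> x" "1 / ((1 - \<gamma>) * \<epsilon>) \<le> x"
    proof -
      have "(1 - \<gamma>) * min \<epsilon> 1 \<le> 1 * 1" using g \<epsilon> by (intro mult_mono) auto
      then show "1 \<le> x" using g \<epsilon> by (simp add: x_def)
      show "1 / (1 - \<gamma>) \<le> x"
        unfolding x_def using g \<epsilon> by (intro divide_left_mono mult_pos_pos) (auto simp: mult_left_le)
      show "1 / ((1 - \<gamma>) * \<epsilon>) \<le> x"
        unfolding x_def using g \<epsilon> by (intro divide_left_mono mult_pos_pos mult_left_mono) auto
    qed
    note N = real_n_SA_ge_1
    obtain I where I: "?R \<le> 2 ^ I * e" "2 ^ I * e \<le> 2 * ?R"
    proof -
      obtain k where k: "?R / e < 2 ^ k" using real_arch_pow[of 2 "?R / e"] by auto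
      \<comment> \<open>Minimality gives the upper bound, as the previous power is still too small;
        a previous power exists because \<open>?R / e\<close> exceeds 1.\<close>
      define I where "I = (LEAST k. ?R / e \<le> 2 ^ k)"
      have I1: "?R / e \<le> 2 ^ I" unfolding I_def using k by (intro LeastI_ex[where P="\<lambda>k. ?R / e \<le> 2 ^ k"] exI[of _ k] less_imp_le)
      have "1 < ?R / e" using R1 e by (simp add: field_simps)
      then have "I \<noteq> 0" using I1 by (cases I) auto
      then obtain j where j: "I = Suc j" using not0_implies_Suc by blast
      then have "\<not> ?R / e \<le> 2 ^ j" using not_less_Least[of j "\<lambda>k. ?R / e \<le> 2 ^ k"] by (simp add: I_def)
      then have "2 ^ I * e \<le> 2 * ?R" using e j by (simp add: field_simps)
      with I1 show thesis using e by (intro that[of I]) (simp_all add: field_simps)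
    qed
    have "2 ^ I \<le> 48 * x\<^sup>2"
    proof -
      have "2 ^ I \<le> 2 * ?R / e" using I e by (simp add: field_simps)
      also have "\<dots> = 48 * (?R * (1 / ((1 - \<gamma>) * \<epsilon>)))" by (simp add: e_def field_simps)
      also have "\<dots> \<le> 48 * (x * x)"
        using x g \<epsilon> R1 norm_opt_value_le by (intro mult_left_mono mult_mono) auto
      finally show ?thesis by (simp add: power2_eq_square)
    qed
    note logs = log_factor_bounds[OF x(1) N \<delta>(1) less_imp_le[OF \<delta>(2)] this]
    define B where "B = loop_bound (2 ^ I) e (\<delta> / c_seq I)"
    let ?l = "ln (2 * x)" and ?\<Lambda> = "ln (2 * ?N * x / \<delta>)"
    have l0: "0 \<le> ?l" using x by simp
    have \<Lambda>0: "0 \<le> ?\<Lambda>"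
    proof -
      have "1 * 1 \<le> 2 * ?N * x" using x N by (intro mult_mono) auto
      then show ?thesis using \<delta> by (intro ln_ge_zero) (simp add: pos_le_divide_eq)
    qed
    have bound_eq: "complexity_bound M \<epsilon> \<delta> = ?\<Lambda> * ?l ^ 4 * (?N * ?R\<^sup>2 / ((1 - \<gamma>)\<^sup>2 * \<epsilon>\<^sup>2))"
      by (simp add: complexity_bound_def L_tilde_def x_def mult_ac)
    have B_le: "(real I + 1) * B \<le> K * complexity_bound M \<epsilon> \<delta>"
    proof -
      let ?X = "?N * (650 * (32 * ?\<Lambda>) * ?R\<^sup>2 * (8 * ?l) ^ 3 / e\<^sup>2)"
      have "B \<le> ?X"
        unfolding B_def using logs \<Lambda>0 R1
        by (intro mult_left_mono divide_right_mono mult_mono power_mono) auto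
      then have "(real I + 1) * B \<le> (real I + 1) * ?X" by (intro mult_left_mono) auto
      also have "\<dots> \<le> (11 * ?l) * ?X"
        using logs(1) l0 \<Lambda>0 by (intro mult_right_mono) auto
      also have "\<dots> = K * complexity_bound M \<epsilon> \<delta>"
      proof -
        have "(11 * l) * (n * (650 * (32 * q) * r * (8 * l) ^ 3 / (w / 576))) = K * (q * l ^ 4 * (n * r / w))"
          if "w \<noteq> 0" for l n q r w :: real
          using that by (simp add: K_def power3_eq_cube power4_eq_xxxx)
        moreover have e_sq: "e\<^sup>2 = (1 - \<gamma>)\<^sup>2 * \<epsilon>\<^sup>2 / 576"
          by (simp add: e_def power_divide power_mult_distrib)
        moreover have "(1 - \<gamma>)\<^sup>2 * \<epsilon>\<^sup>2 \<noteq> 0" using \<epsilon> g by simp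
        ultimately show ?thesis unfolding bound_eq e_sq by blast
      qed
      finally show ?thesis .
    qed
    have "(\<Sum>j=0..I. \<delta> / c_seq j) \<le> \<delta>"
    proof -
      have "(\<Sum>j=0..I. \<delta> / c_seq j) = \<delta> * (\<Sum>j<Suc I. 1 / c_seq j)"
        by (simp add: sum_distrib_left atLeast0AtMost lessThan_Suc_atMost del: sum.lessThan_Suc)
      then show ?thesis using sum_inverse_c_seq_le[of "Suc I"] \<delta> by (simp add: mult_left_le)
    qed
    then have "1 - \<delta> \<le> 1 - (\<Sum>j=0..I. \<delta> / c_seq j)" by simp
    also have "\<dots> \<le> measure (measure_spmf (SAVID_plus M sel c_seq \<beta>_seq (\<lambda>_ _. 0) e \<delta>))
        {out. out_policy out = sel (out_Q out) \<and>
          norm_SA M (\<lambda>s a. out_Q out s a - bellman M (out_Q out) s a) \<le> 12 * e \<and>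
          real (samples out) \<le> (real I + 1) * B \<and> run_time out \<le> 16 * samples out}"
      unfolding SAVID_plus_def B_def
      by (rule prob_SAVID_plus_from) (use I e \<delta> R1 in auto)
    also have "\<dots> \<le> measure (measure_spmf (SAVID_plus M sel c_seq \<beta>_seq (\<lambda>_ _. 0) e \<delta>))
         {out.
            norm_SA M (\<lambda>s a. opt_value M s a - policy_value M (out_policy out) s a)
              \<le> 2 / (1 - \<gamma>) * norm_SA M (\<lambda>s a. out_Q out s a - bellman M (out_Q out) s a) \<and>
            2 / (1 - \<gamma>) * norm_SA M (\<lambda>s a. out_Q out s a - bellman M (out_Q out) s a) \<le> \<epsilon> \<and>
            real (samples out) \<le> 16 * K * complexity_bound M \<epsilon> \<delta> \<and>
            real (run_time out) \<le> 16 * K * complexity_bound M \<epsilon> \<delta>}"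
    proof (rule finite_measure.finite_measure_mono[OF measure_spmf.finite_measure_axioms], safe)
      fix out :: "('s, 'a) savid_output"
      assume pol: "out_policy out = sel (out_Q out)"
        and res: "norm_SA M (\<lambda>s a. out_Q out s a - bellman M (out_Q out) s a) \<le> 12 * e"
        and smp: "real (samples out) \<le> (real I + 1) * B" and time: "run_time out \<le> 16 * samples out"
      show "norm_SA M (\<lambda>s a. opt_value M s a - policy_value M (out_policy out) s a)
          \<le> 2 / (1 - \<gamma>) * norm_SA M (\<lambda>s a. out_Q out s a - bellman M (out_Q out) s a)"
        unfolding pol by (rule greedy_policy_error[OF sel])
      have "2 / (1 - \<gamma>) * norm_SA M (\<lambda>s a. out_Q out s a - bellman M (out_Q out) s a) \<le> 2 / (1 - \<gamma>) * (12 * e)"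
        using g by (intro mult_left_mono res) auto
      \<comment> \<open>The divisor 24 is 2 * 12: the 2 from the greedy policy, the 12 from the
        threshold 11 plus one for the bias.\<close>
      also have "\<dots> = \<epsilon>" using g by (simp add: e_def)
      finally show "2 / (1 - \<gamma>) * norm_SA M (\<lambda>s a. out_Q out s a - bellman M (out_Q out) s a) \<le> \<epsilon>" .
      have "real (samples out) \<le> K * complexity_bound M \<epsilon> \<delta>" using smp B_le by linarith
      moreover have "real (run_time out) \<le> 16 * real (samples out)" using time by linarith
      ultimately show "real (samples out) \<le> 16 * K * complexity_bound M \<epsilon> \<delta>"
        and "real (run_time out) \<le> 16 * K * complexity_bound M \<epsilon> \<delta>"
        by linarith+
    qed simp
    finally show "1 - \<delta> \<le> measure (measure_spmf
           (SAVID_plus M sel c_seq \<beta>_seq (\<lambda>_ _. 0) (\<epsilon> * (1 - discount M) / 24) \<delta>))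
         {out.
            norm_SA M (\<lambda>s a. opt_value M s a - policy_value M (out_policy out) s a)
              \<le> 2 / (1 - discount M) * norm_SA M (\<lambda>s a. out_Q out s a - bellman M (out_Q out) s a) \<and>
            2 / (1 - discount M) * norm_SA M (\<lambda>s a. out_Q out s a - bellman M (out_Q out) s a) \<le> \<epsilon> \<and>
            real (samples out) \<le> 16 * K * complexity_bound M \<epsilon> \<delta> \<and>
            real (run_time out) \<le> 16 * K * complexity_bound M \<epsilon> \<delta>}"
      unfolding e_def .
  qed (simp add: K_def)
qed

end
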